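(* There is a monadic second-order formula $\varepsilon(x,y)$ over the signature $\{\mathrm{ordccw},\mathrm{poledge}\}$ ($\mathrm{ordccw}$ ternary, $\mathrm{poledge}$ binary) such that for every simple polygon $Q$ in the plane with vertex set $P$, viewed as the relational structure on $P$ in which $\mathrm{ordccw}$ is interpreted as the order type $\Omega(P)$ and $\mathrm{poledge}$ as the counter-clockwise directed Hamiltonian cycle of the edges of $Q$, and for all $x,y\in P$: $Q\models\varepsilon(x,y)$ if and only if $\{x,y\}$ is an edge of the visibility graph of $Q$. (That is, the visibility graph of $Q$ has an MSO interpretation in $Q$.)
   Context: The order type of $P$ is the ternary relation $\Omega(P)\subseteq P^3$ with $(a,b,c)\in\Omega(P)$ iff $a,b,c$ are distinct and triangle $abc$ is oriented counter-clockwise. The visibility graph of a polygon $Q$ has the vertices of $Q$ as vertices, and $\{x,y\}$ ($x\neq y$) is an edge iff the line segment $xy$ is disjoint from the complement of the (closed) polygon $Q$. Monadic second-order (MSO) logic over a relational signature has variables for elements and for subsets of the universe, quantifiers over both, equality, membership, Boolean connectives, and atomic formulas $R(x_1,\dots,x_a)$ true iff the tuple belongs to the relation interpreting $R$. *)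

theory Defs
  imports "HOL-Complex_Analysis.Complex_Analysis"
begin

text \<open>
  A signature is a type \<open>'r\<close> of relation symbols with an arity function.
  Element variables and set variables are two separate families, each indexed by \<open>nat\<close>.
\<close>

datatype 'r mso =
    Eq nat nat
  | Mem nat nat  \<comment> \<open>element variable, set variable\<close>
  | Rel 'r "nat list"
  | Neg "'r mso"
  | Conj "'r mso" "'r mso"
  | Disj "'r mso" "'r mso"
  | Impl "'r mso" "'r mso"
  | Forall nat "'r mso"
  | Exists nat "'r mso"
  | ForallSet nat "'r mso"
  | ExistsSet nat "'r mso"

primrec mso_wf :: "('r \<Rightarrow> nat) \<Rightarrow> 'r mso \<Rightarrow> bool" where
  "mso_wf ar (Eq i j) \<longleftrightarrow> True"
| "mso_wf ar (Mem i j) \<longleftrightarrow> True"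
| "mso_wf ar (Rel r is) \<longleftrightarrow> length is = ar r"
| "mso_wf ar (Neg \<phi>) \<longleftrightarrow> mso_wf ar \<phi>"
| "mso_wf ar (Conj \<phi> \<psi>) \<longleftrightarrow> mso_wf ar \<phi> \<and> mso_wf ar \<psi>"
| "mso_wf ar (Disj \<phi> \<psi>) \<longleftrightarrow> mso_wf ar \<phi> \<and> mso_wf ar \<psi>"
| "mso_wf ar (Impl \<phi> \<psi>) \<longleftrightarrow> mso_wf ar \<phi> \<and> mso_wf ar \<psi>"
| "mso_wf ar (Forall i \<phi>) \<longleftrightarrow> mso_wf ar \<phi>"
| "mso_wf ar (Exists i \<phi>) \<longleftrightarrow> mso_wf ar \<phi>"
| "mso_wf ar (ForallSet i \<phi>) \<longleftrightarrow> mso_wf ar \<phi>"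
| "mso_wf ar (ExistsSet i \<phi>) \<longleftrightarrow> mso_wf ar \<phi>"

primrec free_elem_vars :: "'r mso \<Rightarrow> nat set" where
  "free_elem_vars (Eq i j) = {i, j}"
| "free_elem_vars (Mem i j) = {i}"
| "free_elem_vars (Rel r is) = set is"
| "free_elem_vars (Neg \<phi>) = free_elem_vars \<phi>"
| "free_elem_vars (Conj \<phi> \<psi>) = free_elem_vars \<phi> \<union> free_elem_vars \<psi>"
| "free_elem_vars (Disj \<phi> \<psi>) = free_elem_vars \<phi> \<union> free_elem_vars \<psi>"
| "free_elem_vars (Impl \<phi> \<psi>) = free_elem_vars \<phi> \<union> free_elem_vars \<psi>"
| "free_elem_vars (Forall i \<phi>) = free_elem_vars \<phi> - {i}"
| "free_elem_vars (Exists i \<phi>) = free_elem_vars \<phi> - {i}"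
| "free_elem_vars (ForallSet i \<phi>) = free_elem_vars \<phi>"
| "free_elem_vars (ExistsSet i \<phi>) = free_elem_vars \<phi>"

primrec free_set_vars :: "'r mso \<Rightarrow> nat set" where
  "free_set_vars (Eq i j) = {}"
| "free_set_vars (Mem i j) = {j}"
| "free_set_vars (Rel r is) = {}"
| "free_set_vars (Neg \<phi>) = free_set_vars \<phi>"
| "free_set_vars (Conj \<phi> \<psi>) = free_set_vars \<phi> \<union> free_set_vars \<psi>"
| "free_set_vars (Disj \<phi> \<psi>) = free_set_vars \<phi> \<union> free_set_vars \<psi>"
| "free_set_vars (Impl \<phi> \<psi>) = free_set_vars \<phi> \<union> free_set_vars \<psi>"
| "free_set_vars (Forall i \<phi>) = free_set_vars \<phi>"
| "free_set_vars (Exists i \<phi>) = free_set_vars \<phi>"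
| "free_set_vars (ForallSet i \<phi>) = free_set_vars \<phi> - {i}"
| "free_set_vars (ExistsSet i \<phi>) = free_set_vars \<phi> - {i}"

record ('r, 'a) rel_structure =
  universe :: "'a set"
  interp :: "'r \<Rightarrow> 'a list set"

primrec mso_sat ::
  "('r, 'a) rel_structure \<Rightarrow> (nat \<Rightarrow> 'a) \<Rightarrow> (nat \<Rightarrow> 'a set) \<Rightarrow> 'r mso \<Rightarrow> bool"
where
  "mso_sat M e E (Eq i j) \<longleftrightarrow> e i = e j"
| "mso_sat M e E (Mem i j) \<longleftrightarrow> e i \<in> E j"
| "mso_sat M e E (Rel r is) \<longleftrightarrow> map e is \<in> interp M r"
| "mso_sat M e E (Neg \<phi>) \<longleftrightarrow> \<not> mso_sat M e E \<phi>"
| "mso_sat M e E (Conj \<phi> \<psi>) \<longleftrightarrow> mso_sat M e E \<phi> \<and> mso_sat M e E \<psi>"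
| "mso_sat M e E (Disj \<phi> \<psi>) \<longleftrightarrow> mso_sat M e E \<phi> \<or> mso_sat M e E \<psi>"
| "mso_sat M e E (Impl \<phi> \<psi>) \<longleftrightarrow> (mso_sat M e E \<phi> \<longrightarrow> mso_sat M e E \<psi>)"
| "mso_sat M e E (Forall i \<phi>) \<longleftrightarrow> (\<forall>a\<in>universe M. mso_sat M (e(i := a)) E \<phi>)"
| "mso_sat M e E (Exists i \<phi>) \<longleftrightarrow> (\<exists>a\<in>universe M. mso_sat M (e(i := a)) E \<phi>)"
| "mso_sat M e E (ForallSet i \<phi>) \<longleftrightarrow> (\<forall>A. A \<subseteq> universe M \<longrightarrow> mso_sat M e (E(i := A)) \<phi>)"
| "mso_sat M e E (ExistsSet i \<phi>) \<longleftrightarrow> (\<exists>A. A \<subseteq> universe M \<and> mso_sat M e (E(i := A)) \<phi>)"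

definition mso_binary_formula :: "('r \<Rightarrow> nat) \<Rightarrow> 'r mso \<Rightarrow> bool" where
  "mso_binary_formula ar \<phi> \<longleftrightarrow>
     mso_wf ar \<phi> \<and> free_elem_vars \<phi> \<subseteq> {0, 1} \<and> free_set_vars \<phi> = {}"

text \<open>
  For a formula \<open>\<phi>\<close> as in \<open>mso_binary_formula\<close>, element variables \<open>0\<close> and \<open>1\<close> play
  the roles of \<open>x\<close> and \<open>y\<close>; the values of all other variables are irrelevant.
\<close>

definition mso_sat2 :: "('r, 'a) rel_structure \<Rightarrow> 'r mso \<Rightarrow> 'a \<Rightarrow> 'a \<Rightarrow> bool" where
  "mso_sat2 M \<phi> x y \<longleftrightarrow> mso_sat M ((\<lambda>_. x)(1 := y)) (\<lambda>_. {}) \<phi>"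

text \<open>The imaginary part below is twice the signed area of the triangle \<open>a b c\<close>.\<close>

definition ccw_triangle :: "complex \<Rightarrow> complex \<Rightarrow> complex \<Rightarrow> bool" where
  "ccw_triangle a b c \<longleftrightarrow> Im (cnj (b - a) * (c - a)) > 0"

definition order_type :: "complex set \<Rightarrow> (complex \<times> complex \<times> complex) set" where
  "order_type P =
     {(a, b, c). a \<in> P \<and> b \<in> P \<and> c \<in> P \<and> distinct [a, b, c] \<and> ccw_triangle a b c}"

fun polygonal_path :: "complex list \<Rightarrow> real \<Rightarrow> complex" where
  "polygonal_path [] = linepath 0 0"
| "polygonal_path [a] = linepath a a"
| "polygonal_path [a, b] = linepath a b"
| "polygonal_path (a # b # c # vs) = linepath a b +++ polygonal_path (b # c # vs)"

text \<open>
  A polygon is given by the cyclic sequence of its vertices, listed in either direction.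
  Collinear vertices, in particular straight angles, are allowed.
\<close>

definition boundary_path :: "complex list \<Rightarrow> real \<Rightarrow> complex" where
  "boundary_path vs = polygonal_path (vs @ [hd vs])"

definition simple_polygon :: "complex list \<Rightarrow> bool" where
  "simple_polygon vs \<longleftrightarrow> length vs \<ge> 3 \<and> simple_path (boundary_path vs)"

definition polygon_region :: "complex list \<Rightarrow> complex set" where
  "polygon_region vs =
     path_image (boundary_path vs) \<union> inside (path_image (boundary_path vs))"

definition ccw_listed :: "complex list \<Rightarrow> bool" where
  "ccw_listed vs \<longleftrightarrow>
     (\<forall>z \<in> inside (path_image (boundary_path vs)). winding_number (boundary_path vs) z = 1)"

definition successive_pairs :: "complex list \<Rightarrow> (complex \<times> complex) set" where
  "successive_pairs vs = {(vs ! i, vs ! (Suc i mod length vs)) | i. i < length vs}"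

text \<open>
  For a simple polygon the winding number is constantly \<open>1\<close> or constantly \<open>-1\<close> on the inside
  (\<open>simple_closed_path_winding_number_inside\<close>); in the latter case the vertices are listed
  clockwise.
\<close>

definition ccw_cycle :: "complex list \<Rightarrow> (complex \<times> complex) set" where
  "ccw_cycle vs = (if ccw_listed vs then successive_pairs vs else (successive_pairs vs)\<inverse>)"

definition visibility_edges :: "complex list \<Rightarrow> complex set set" where
  "visibility_edges vs =
     {{x, y} | x y. x \<in> set vs \<and> y \<in> set vs \<and> x \<noteq> y \<and>
        closed_segment x y \<inter> - polygon_region vs = {}}"

datatype polygon_sym = ordccw | poledge

primrec polygon_arity :: "polygon_sym \<Rightarrow> nat" where
  "polygon_arity ordccw = 3"
| "polygon_arity poledge = 2"

primrec polygon_interp :: "complex list \<Rightarrow> polygon_sym \<Rightarrow> complex list set" where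
  "polygon_interp vs ordccw = {[a, b, c] | a b c. (a, b, c) \<in> order_type (set vs)}"
| "polygon_interp vs poledge = {[a, b] | a b. (a, b) \<in> ccw_cycle vs}"

definition polygon_structure :: "complex list \<Rightarrow> (polygon_sym, complex) rel_structure" where
  "polygon_structure vs = \<lparr>universe = set vs, interp = polygon_interp vs\<rparr>"

end

theory Submission
  imports Defs
begin

text \<open>
  Visibility is already definable without set quantifiers.
  Some vertex lies off any given line, and seen from it the order type sorts the vertices on that
  line, so betweenness of vertices is definable and a segment can be cut at the vertices on it.
  A piece \<open>u v\<close> without inner vertices is a polygon edge, or is properly crossed by one (and then
  leaves the polygon), or misses the boundary. In the last case it runs entirely inside or entirely
  outside, which is read off from the cyclic order of the two edges at \<open>u\<close> and the direction of \<open>v\<close>,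
  because the inside lies to the left of every edge of the counter-clockwise cycle.
\<close>

subsection \<open>Orientation of triangles\<close>

text \<open>Orientation and inside are linked by winding numbers: crossing an edge from its right to
  its left raises the winding number of the boundary by one. As this number is 0 outside and
  constantly 1 or constantly -1 inside, exactly one side of an edge is inside, and the direction
  chosen in \<open>ccw_cycle\<close> makes it the left one. The obstacle is degeneracy. Vertices may
  be collinear, so a segment can pass through vertices, run along edges, or leave a vertex exactly
  opposite to an edge, where strict orientations say nothing. Cutting at the vertices removes the
  partial overlaps. At a vertex, the side is read from whichever of its two edges is not shadowed by
  the other one, and a vanishing orientation can then only mean opposite rays. All tests use
  positive orientations, because these are what \<open>ordccw\<close> expresses.\<close>

definition orient :: "complex \<Rightarrow> complex \<Rightarrow> complex \<Rightarrow> real" where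
  "orient a b c = Im (cnj (b - a) * (c - a))"

lemma ccw_triangle_orient: "ccw_triangle a b c \<longleftrightarrow> orient a b c > 0"
  by (simp add: ccw_triangle_def orient_def)

lemma orient_coord:
  "orient a b c = (Re b - Re a) * (Im c - Im a) - (Im b - Im a) * (Re c - Re a)"
  by (simp add: orient_def algebra_simps)

lemma orient_cycle: "orient b c a = orient a b c"
  by (simp add: orient_coord algebra_simps)

lemma orient_swap: "orient b a c = - orient a b c"
  by (simp add: orient_coord algebra_simps)

lemma orient_same [simp]: "orient a a b = 0" "orient a b a = 0" "orient b a a = 0"
  by (simp_all add: orient_coord)

lemma orient_affine: "orient a b ((1 - t) *\<^sub>R c + t *\<^sub>R d) = (1 - t) * orient a b c + t * orient a b d"
  by (simp add: orient_coord algebra_simps)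

lemma orient_add_scaleR: "orient a b (c + t *\<^sub>R (d - c)) = (1 - t) * orient a b c + t * orient a b d"
  by (simp add: orient_coord algebra_simps)

lemma continuous_on_orient [continuous_intros]: "continuous_on S (orient a b)"
  unfolding orient_def by (intro continuous_intros)

lemma open_left: "open {q. orient a b q > 0}"
  by (intro open_Collect_less continuous_intros)

lemma orient_convex_comb: "u + v = 1 \<Longrightarrow> orient a b (u *\<^sub>R x + v *\<^sub>R y) = u * orient a b x + v * orient a b y"
  using orient_affine[of a b v x y] by (metis add_diff_cancel_right')

text \<open>The sign of \<open>D\<close> selects the side of the line, so that \<open>sector\<close>
  can treat both orientations at once.\<close>

lemma convex_side: "convex {q. D * orient a b q > 0}" "convex {q. D * orient a b q \<ge> 0}"
proof -
  have *: "D * orient a b (u *\<^sub>R x + v *\<^sub>R y) = u * (D * orient a b x) + v * (D * orient a b y)"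
    if "u + v = 1" for u v x y
    using orient_convex_comb[OF that, of a b x y] by (simp add: algebra_simps)
  show "convex {q. D * orient a b q > 0}"
    unfolding convex_def
  proof (clarsimp simp: * simp del: zero_less_mult_iff)
    fix x y and u v :: real
    assume "0 < D * orient a b x" "0 < D * orient a b y" "0 \<le> u" "0 \<le> v" "u + v = 1"
    then show "0 < u * (D * orient a b x) + v * (D * orient a b y)"
      by (cases "u = 0") (auto intro!: add_pos_nonneg simp del: zero_less_mult_iff)
  qed
  show "convex {q. D * orient a b q \<ge> 0}"
    unfolding convex_def by (clarsimp simp: * simp del: zero_le_mult_iff) 
qed

section \<open>Winding numbers of triangles\<close>

lemma barycentric:
  "orient a b c *\<^sub>R z = orient b c z *\<^sub>R a + orient c a z *\<^sub>R b + orient a b z *\<^sub>R c"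
  by (rule complex_eqI; simp add: orient_coord algebra_simps)

lemma left_of_triangle_interior:
  assumes "orient a b z > 0" "orient b c z > 0" "orient c a z > 0"
  shows "z \<in> interior (convex hull {a, b, c})"
proof -
  have sum: "orient a b z + orient b c z + orient c a z = orient a b c"
    by (simp add: orient_coord algebra_simps)
  define D where "D = orient a b c"
  have D: "D > 0" using sum assms by (simp add: D_def)
  have nc: "\<not> collinear {a, b, c}"
  proof
    assume "collinear {a, b, c}"
    then obtain u where u: "\<forall>x\<in>{a,b,c}. \<forall>y\<in>{a,b,c}. \<exists>c. x - y = c *\<^sub>R u"
      unfolding collinear_def by blast
    then obtain r s where "b - a = r *\<^sub>R u" "c - a = s *\<^sub>R u" by blast
    then have "orient a b c = 0" by (simp add: orient_def)
    with D show False by (simp add: D_def)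
  qed
  have "z = inverse D *\<^sub>R (D *\<^sub>R z)" using D by simp
  also have "D *\<^sub>R z = orient b c z *\<^sub>R a + orient c a z *\<^sub>R b + orient a b z *\<^sub>R c"
    unfolding D_def by (rule barycentric)
  finally have z: "(orient b c z / D) *\<^sub>R a + (orient c a z / D) *\<^sub>R b + (orient a b z / D) *\<^sub>R c = z"
    by (simp add: scaleR_add_right divide_inverse mult.commute)
  have "orient b c z / D + orient c a z / D + orient a b z / D = 1"
    using D sum by (simp add: D_def flip: add_divide_distrib)
  then show ?thesis
    unfolding interior_convex_hull_3_minimal[OF nc DIM_complex]
    using z assms D by (metis (mono_tags, lifting) divide_pos_pos mem_Collect_eq)
qed

text \<open>The conditions force the triangle to run counter-clockwise around \<open>z\<close>. The
  sum over the sides is the form that can be compared with a sum over polygon edges.\<close>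

lemma winding_number_left_of_triangle:
  assumes "orient a b z > 0" "orient b c z > 0" "orient c a z > 0"
  shows "winding_number (linepath a b) z + winding_number (linepath b c) z
    + winding_number (linepath c a) z = 1"
proof -
  have int: "z \<in> interior (convex hull {a, b, c})"
    using assms by (rule left_of_triangle_interior)
  have *: "Im ((b - a) * cnj (b - z)) = orient a b z" for a b z
    by (simp add: orient_coord algebra_simps)
  have "winding_number (linepath a b +++ linepath b c +++ linepath c a) z = 1"
    using int assms by (intro wn_triangle3) (simp_all only: *)
  moreover have off: "z \<notin> closed_segment a b" if "orient a b z > 0" for a b
    using that unfolding closed_segment_def by (auto simp: orient_affine)
  ultimately show ?thesis
    using assms by (simp add: winding_number_join off path_image_join add.assoc)
qed

text \<open>The triangle, possibly degenerate, stays in the closed half-plane to the right of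
  \<open>a b\<close>, and \<open>z\<close> is strictly to the left.\<close>

lemma winding_number_outside_triangle:
  assumes "orient a b z > 0" "orient a b c \<le> 0"
  shows "winding_number (linepath a b) z + winding_number (linepath b c) z
    + winding_number (linepath c a) z = 0"
proof -
  have sub: "convex hull {a, b, c} \<subseteq> {q. orient b a q \<ge> 0}"
    using assms(2) orient_swap[of a b c] by (intro hull_minimal convex_side(2)[of 1, simplified]) auto
  have segs: "closed_segment a b \<subseteq> convex hull {a, b, c}" "closed_segment b c \<subseteq> convex hull {a, b, c}"
    "closed_segment c a \<subseteq> convex hull {a, b, c}"
    by (intro closed_segment_subset_convex_hull; auto intro: hull_inc)+
  have "z \<notin> convex hull {a, b, c}"
    using sub assms(1) orient_swap[of a b z] by auto
  moreover from this have "winding_number (linepath a b +++ linepath b c +++ linepath c a) z = 0"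
    using segs
    by (intro winding_number_zero_outside[where s="convex hull {a, b, c}"]) (auto simp: path_image_join)
  ultimately show ?thesis
    using segs by (subst (asm) winding_number_join; (subst (asm) winding_number_join)?)
      (auto simp: path_image_join add.assoc)
qed

section \<open>Points on lines and segments\<close>

lemma in_open_segment_combo:
  "(1 - t) *\<^sub>R x + t *\<^sub>R y \<in> open_segment x y" if "0 < t" "t < 1" "x \<noteq> (y::complex)"
  using that by (auto simp: in_segment)

lemma orient_eq_0_on_line:
  "orient a b q = 0" if "q \<in> closed_segment a b"
  using that by (auto simp: in_segment orient_affine)

lemma collinear_param:
  assumes "orient a b c = 0" "a \<noteq> b"
  obtains t where "c = a + t *\<^sub>R (b - a)"
proof -
  define d where "d = b - a"
  \<comment> \<open>The coefficient of the orthogonal projection of \<open>c - a\<close> onto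
    \<open>d\<close>; collinearity makes the projection exact.\<close>
  define t where "t = ((Re c - Re a) * Re d + (Im c - Im a) * Im d) / ((Re d)\<^sup>2 + (Im d)\<^sup>2)"
  have d: "(Re d)\<^sup>2 + (Im d)\<^sup>2 \<noteq> 0"
    using assms(2) by (auto simp: d_def complex_eq_iff sum_power2_eq_zero_iff)
  have o: "Re d * (Im c - Im a) = Im d * (Re c - Re a)"
    using assms(1) by (simp add: orient_coord d_def)
  have "c = a + t *\<^sub>R d"
  proof (rule complex_eqI)
    have "(Re c - Re a) * ((Re d)\<^sup>2 + (Im d)\<^sup>2) = ((Re c - Re a) * Re d + (Im c - Im a) * Im d) * Re d"
      using o by algebra
    then show "Re c = Re (a + t *\<^sub>R d)" using d by (simp add: t_def field_simps)
    have "(Im c - Im a) * ((Re d)\<^sup>2 + (Im d)\<^sup>2) = ((Re c - Re a) * Re d + (Im c - Im a) * Im d) * Im d"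
      using o by algebra
    then show "Im c = Im (a + t *\<^sub>R d)" using d by (simp add: t_def field_simps)
  qed
  then show ?thesis using that unfolding d_def by blast
qed

lemma in_open_segment_add:
  "x + t *\<^sub>R (y - x) \<in> open_segment x y" if "0 < t" "t < 1" "x \<noteq> (y::complex)"
proof -
  have "x + t *\<^sub>R (y - x) = (1 - t) *\<^sub>R x + t *\<^sub>R y" by (simp add: algebra_simps)
  then show ?thesis using in_open_segment_combo that by simp
qed

lemma exists_small_step:
  fixes x y :: complex
  assumes "open U" "y \<in> U"
  shows "\<exists>r. 0 < r \<and> r < 1 \<and> y + r *\<^sub>R (x - y) \<in> U"
proof -
  obtain e where e: "e > 0" "ball y e \<subseteq> U" using assms openE by blast
  \<comment> \<open>The summand 1 keeps the denominator positive when \<open>x = y\<close>.\<close>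
  define r where "r = min (1/2) (e / (2 * (norm (x - y) + 1)))"
  have n: "norm (x - y) + 1 > 0" by (simp add: add_nonneg_pos)
  have "r * norm (x - y) \<le> e / (2 * (norm (x - y) + 1)) * (norm (x - y) + 1)"
    unfolding r_def using e(1) n by (intro mult_mono) auto
  also have "\<dots> = e / 2" using n by (simp add: field_simps)
  also have "\<dots> < e" using e(1) by simp
  finally have "r * norm (x - y) < e" .
  moreover have r: "0 < r" "r < 1" using e(1) n by (auto simp: r_def)
  ultimately have "y + r *\<^sub>R (x - y) \<in> ball y e" by (simp add: dist_norm)
  then show ?thesis using r e by blast
qed

subsection \<open>Polygonal paths\<close>

fun segs :: "'a list \<Rightarrow> ('a \<times> 'a) list" where
  "segs (a # b # l) = (a, b) # segs (b # l)"
| "segs _ = []"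

lemma segs_append: "segs (xs @ a # ys) = segs (xs @ [a]) @ segs (a # ys)"
  by (induction xs rule: segs.induct) auto

lemma map_fst_segs: "map fst (segs l) = butlast l"
  by (induction l rule: segs.induct) auto

lemma in_segsD: "(a, b) \<in> set (segs l) \<Longrightarrow> \<exists>xs ys. l = xs @ a # b # ys"
proof (induction l rule: segs.induct)
  case (1 x y l)
  show ?case
  proof (cases "(a, b) = (x, y)")
    case True then show ?thesis by (metis append_Nil prod.inject)
  next
    case False
    then obtain xs ys where "y # l = xs @ a # b # ys" using 1 by auto
    then show ?thesis by (metis append_Cons)
  qed
qed auto

lemma set_segs_nth: "set (segs l) = {(l ! i, l ! Suc i) | i. Suc i < length l}"
proof -
  have "segs l = zip l (tl l)"
    by (induction l rule: segs.induct) auto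
  then have *: "set (segs l) = set (zip l (tl l))" by simp
  show ?thesis unfolding *
    unfolding set_zip by (intro Collect_cong ex_cong1) (auto simp: nth_tl)
qed

lemma path_polygonal [simp]: "path (polygonal_path l)"
  and pathstart_polygonal: "l \<noteq> [] \<Longrightarrow> pathstart (polygonal_path l) = hd l"
  by (induction l rule: polygonal_path.induct) auto

lemma pathfinish_polygonal: "l \<noteq> [] \<Longrightarrow> pathfinish (polygonal_path l) = last l"
  by (induction l rule: polygonal_path.induct) auto

lemma path_image_polygonal:
  "length l \<ge> 2 \<Longrightarrow> path_image (polygonal_path l) = (\<Union>(a, b)\<in>set (segs l). closed_segment a b)"
  by (induction l rule: polygonal_path.induct) (auto simp: path_image_join pathstart_polygonal)

text \<open>As a sum over segments, the winding number changes only locally when one edge is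
  replaced by a detour.\<close>

lemma winding_number_polygonal:
  "length l \<ge> 2 \<Longrightarrow> q \<notin> path_image (polygonal_path l) \<Longrightarrow>
   winding_number (polygonal_path l) q = (\<Sum>(a, b)\<leftarrow>segs l. winding_number (linepath a b) q)"
  by (induction l rule: polygonal_path.induct)
    (auto simp: path_image_join pathstart_polygonal winding_number_join)

text \<open>Peel off the first segment: \<open>arc_join_eq\<close> lets it meet the rest only in
  \<open>b\<close>. Any other segment through \<open>b\<close> has \<open>b\<close> as an end, by
  the induction hypothesis applied to it and the segment \<open>b c\<close>.\<close>

lemma arc_polygonal:
  assumes "arc (polygonal_path l)" "length l \<ge> 2"
  shows "distinct l \<and> (\<forall>a b c d. (a, b) \<in> set (segs l) \<longrightarrow> (c, d) \<in> set (segs l) \<longrightarrow>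
     (a, b) \<noteq> (c, d) \<longrightarrow> closed_segment a b \<inter> closed_segment c d \<subseteq> {a, b} \<inter> {c, d})"
  using assms
proof (induction l rule: polygonal_path.induct)
  case (4 a b c vs)
  let ?r = "polygonal_path (b # c # vs)"
  have "arc (linepath a b) \<and> arc ?r \<and> closed_segment a b \<inter> path_image ?r \<subseteq> {b}"
    using 4(2) by (simp add: arc_join_eq pathstart_polygonal)
  then have ab: "a \<noteq> b" and r: "arc ?r" and int: "closed_segment a b \<inter> path_image ?r \<subseteq> {b}"
    using arc_distinct_ends by fastforce+
  have pi: "path_image ?r = (\<Union>(a, b)\<in>set (segs (b # c # vs)). closed_segment a b)"
    by (rule path_image_polygonal) simp
  have len: "2 \<le> length (b # c # vs)" by simp
  note H = 4(1)[OF r len]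
  have IH1: "distinct (b # c # vs)" and
    IH: "\<And>x y u v. (x, y)\<in>set (segs (b # c # vs)) \<Longrightarrow> (u, v)\<in>set (segs (b # c # vs)) \<Longrightarrow>
       (x, y) \<noteq> (u, v) \<Longrightarrow> closed_segment x y \<inter> closed_segment u v \<subseteq> {x, y} \<inter> {u, v}"
    using H by blast+
  have "set (b # c # vs) \<subseteq> path_image ?r"
  proof
    fix x assume "x \<in> set (b # c # vs)"
    then obtain i where i: "i < length (b # c # vs)" "x = (b # c # vs) ! i" by (metis in_set_conv_nth)
    then show "x \<in> path_image ?r"
    proof (cases i)
      case 0 with i show ?thesis by (simp add: pi)
    next
      case (Suc j)
      then have "((b # c # vs) ! j, x) \<in> set (segs (b # c # vs))" using i by (auto simp only: set_segs_nth)
      then show ?thesis unfolding pi by (rule UN_I) (simp only: prod.case ends_in_segment)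
    qed
  qed
  then have "a \<notin> set (b # c # vs)" using int ab by auto
  have new: "closed_segment a b \<inter> closed_segment u v \<subseteq> {a, b} \<inter> {u, v}"
    if uv: "(u, v) \<in> set (segs (b # c # vs))" for u v
  proof
    fix x assume x: "x \<in> closed_segment a b \<inter> closed_segment u v"
    then have xb: "x = b" using int uv unfolding pi by blast
    moreover have "b \<in> {u, v}"
    proof (cases "(u, v) = (b, c)")
      case False
      have "b \<in> closed_segment b c \<inter> closed_segment u v" using x xb by simp
      then show ?thesis using IH[of b c u v] uv False by auto
    qed auto
    ultimately show "x \<in> {a, b} \<inter> {u, v}" by auto
  qed
  have "closed_segment x y \<inter> closed_segment u v \<subseteq> {x, y} \<inter> {u, v}"
    if xy: "(x, y) \<in> set (segs (a # b # c # vs))" "(u, v) \<in> set (segs (a # b # c # vs))" "(x, y) \<noteq> (u, v)"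
    for x y u v
  proof -
    consider "(x, y) = (a, b)" "(u, v) \<in> set (segs (b # c # vs))"
      | "(u, v) = (a, b)" "(x, y) \<in> set (segs (b # c # vs))"
      | "(x, y) \<in> set (segs (b # c # vs))" "(u, v) \<in> set (segs (b # c # vs))"
      using xy unfolding segs.simps(1)[of a b] by auto
    then show ?thesis
    proof cases
      case 1 then show ?thesis using new by blast
    next
      case 2 then show ?thesis using new by blast
    next
      case 3 then show ?thesis using IH xy(3) by blast
    qed
  qed
  then have "\<forall>x y u v. (x, y) \<in> set (segs (a # b # c # vs)) \<longrightarrow> (u, v) \<in> set (segs (a # b # c # vs)) \<longrightarrow>
     (x, y) \<noteq> (u, v) \<longrightarrow> closed_segment x y \<inter> closed_segment u v \<subseteq> {x, y} \<inter> {u, v}" by blast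
  moreover have "distinct (a # b # c # vs)" using IH1 \<open>a \<notin> _\<close> by simp
  ultimately show ?case by blast
qed (auto dest: arc_distinct_ends)

section \<open>The closed boundary and its cyclic sequence of vertices\<close>

lemma successive_pairs_segs:
  assumes "vs \<noteq> []"
  shows "successive_pairs vs = set (segs (vs @ [hd vs]))"
proof -
  have "(vs @ [hd vs]) ! Suc i = vs ! (Suc i mod length vs)" if "i < length vs" for i
  proof (cases "Suc i = length vs")
    case True
    then show ?thesis using assms by (simp add: nth_append hd_conv_nth)
  next
    case False
    then show ?thesis using that by (simp add: nth_append)
  qed
  moreover have "(vs @ [hd vs]) ! i = vs ! i" if "i < length vs" for i
    using that by (simp add: nth_append)
  ultimately show ?thesis
    unfolding successive_pairs_def set_segs_nth by (intro Collect_cong ex_cong1) auto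
qed

lemma path_image_boundary:
  "vs \<noteq> [] \<Longrightarrow> path_image (boundary_path vs) = (\<Union>(a, b)\<in>successive_pairs vs. closed_segment a b)"
  by (cases vs) (simp_all add: boundary_path_def path_image_polygonal successive_pairs_segs)

text \<open>The closed boundary is not an arc, so its first edge \<open>p q\<close> is split off.
  The rest is an arc from \<open>q\<close> to \<open>p\<close>, to which
  \<open>arc_polygonal\<close> applies, and \<open>simple_path_join_loop_eq\<close> lets the two
  parts meet only in \<open>p\<close> and \<open>q\<close>.\<close>

lemma simple_polygon_vertices:
  assumes "simple_polygon vs"
  shows "distinct vs" "vs \<noteq> []"
    and "(a, b) \<in> successive_pairs vs \<Longrightarrow> (c, d) \<in> successive_pairs vs \<Longrightarrow> (a, b) \<noteq> (c, d) \<Longrightarrow>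
      closed_segment a b \<inter> closed_segment c d \<subseteq> {a, b} \<inter> {c, d}"
proof -
  have "length vs \<ge> 3" using assms by (simp add: simple_polygon_def)
  then obtain p q r ws where vs: "vs = p # q # r # ws"
    by (metis One_nat_def Suc_le_length_iff numeral_3_eq_3)
  show "vs \<noteq> []" using vs by simp
  define l where "l = q # r # ws @ [p]"
  let ?r = "polygonal_path l"
  have len: "length l \<ge> 2" by (simp add: l_def)
  have ends: "pathstart ?r = q" "pathfinish ?r = p"
    using pathstart_polygonal[of l] pathfinish_polygonal[of l] by (simp_all add: l_def)
  have "boundary_path vs = linepath p q +++ ?r"
    by (simp add: boundary_path_def vs l_def)
  then have "simple_path (linepath p q +++ ?r)"
    using assms by (simp add: simple_polygon_def)
  then have pq: "arc (linepath p q)" and arc: "arc ?r"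
    and int: "closed_segment p q \<inter> path_image ?r \<subseteq> {p, q}"
    using simple_path_join_loop_eq[of ?r "linepath p q"] by (auto simp: ends)
  note H = arc_polygonal[OF arc len]
  then show "distinct vs" by (auto simp: l_def vs)
  have H2: "closed_segment x y \<inter> closed_segment u v \<subseteq> {x, y} \<inter> {u, v}"
    if "(x, y) \<in> set (segs l)" "(u, v) \<in> set (segs l)" "(x, y) \<noteq> (u, v)" for x y u v
    using H that by blast
  have SP: "successive_pairs vs = insert (p, q) (set (segs l))"
    unfolding successive_pairs_segs[OF \<open>vs \<noteq> []\<close>] by (simp add: vs l_def)
  have qr: "(q, r) \<in> set (segs l)" by (simp add: l_def)
  \<comment> \<open>The segment of \<open>l\<close> that ends in \<open>p\<close> serves below as
    the witness that every segment through \<open>p\<close> has \<open>p\<close> as an end.\<close>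
  have "l = (butlast (q # r # ws) @ [last (q # r # ws)]) @ [p]"
    by (subst append_butlast_last_id) (simp_all add: l_def)
  then have "segs l = segs (butlast (q # r # ws) @ [last (q # r # ws)]) @ segs [last (q # r # ws), p]"
    using segs_append[of "butlast (q # r # ws)" "last (q # r # ws)" "[p]"] by simp
  then have lp: "(last (q # r # ws), p) \<in> set (segs l)" by simp
  have new: "closed_segment p q \<inter> closed_segment u v \<subseteq> {p, q} \<inter> {u, v}"
    if uv: "(u, v) \<in> set (segs l)" for u v
  proof
    fix x assume x: "x \<in> closed_segment p q \<inter> closed_segment u v"
    moreover have "closed_segment u v \<subseteq> path_image ?r"
      using uv path_image_polygonal[OF len] by auto
    ultimately have xpq: "x \<in> {p, q}" using int by auto
    moreover have "x \<in> {u, v}" if "x = q"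
    proof (cases "(u, v) = (q, r)")
      case False
      have "q \<in> closed_segment q r \<inter> closed_segment u v" using x that by simp
      then show ?thesis using H2[OF qr uv] False that by auto
    qed (use that in auto)
    moreover have "x \<in> {u, v}" if "x = p"
    proof (cases "(u, v) = (last (q # r # ws), p)")
      case False
      have "p \<in> closed_segment (last (q # r # ws)) p \<inter> closed_segment u v" using x that by simp
      then show ?thesis using H2[OF lp uv] False that by blast
    qed (use that in auto)
    ultimately show "x \<in> {p, q} \<inter> {u, v}" by blast
  qed
  show "closed_segment a b \<inter> closed_segment c d \<subseteq> {a, b} \<inter> {c, d}"
    if abcd: "(a, b) \<in> successive_pairs vs" "(c, d) \<in> successive_pairs vs" "(a, b) \<noteq> (c, d)"
  proof -
    consider "(a, b) = (p, q)" "(c, d) \<in> set (segs l)"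
      | "(c, d) = (p, q)" "(a, b) \<in> set (segs l)"
      | "(a, b) \<in> set (segs l)" "(c, d) \<in> set (segs l)"
      using abcd unfolding SP by auto
    then show ?thesis
    proof cases
      case 1 then show ?thesis using new by blast
    next
      case 2 then show ?thesis using new by blast
    next
      case 3 then show ?thesis using H2 abcd(3) by blast
    qed
  qed
qed

lemma successive_pairs_vertices:
  assumes "distinct vs"
  shows "(a, b) \<in> successive_pairs vs \<Longrightarrow> a \<in> set vs \<and> b \<in> set vs"
    and "a \<in> set vs \<Longrightarrow> \<exists>b. (a, b) \<in> successive_pairs vs"
    and "b \<in> set vs \<Longrightarrow> \<exists>a. (a, b) \<in> successive_pairs vs"
    and "(a, b) \<in> successive_pairs vs \<Longrightarrow> (a, c) \<in> successive_pairs vs \<Longrightarrow> b = c"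
    and "(a, c) \<in> successive_pairs vs \<Longrightarrow> (b, c) \<in> successive_pairs vs \<Longrightarrow> a = b"
proof -
  let ?n = "length vs"
  have suc_less: "Suc i mod ?n < ?n" if "i < ?n" for i
    using that by (intro mod_less_divisor) linarith
  show "a \<in> set vs \<and> b \<in> set vs" if ab: "(a, b) \<in> successive_pairs vs"
  proof -
    obtain i where "i < ?n" "a = vs ! i" "b = vs ! (Suc i mod ?n)"
      using ab unfolding successive_pairs_def by blast
    then show ?thesis using suc_less by simp
  qed
  show "\<exists>b. (a, b) \<in> successive_pairs vs" if av: "a \<in> set vs"
  proof -
    obtain i where "i < ?n" "a = vs ! i" using av by (metis in_set_conv_nth)
    then show ?thesis unfolding successive_pairs_def by blast
  qed
  show "\<exists>a. (a, b) \<in> successive_pairs vs" if bv: "b \<in> set vs"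
  proof -
    obtain i where i: "i < ?n" "b = vs ! i" using bv by (metis in_set_conv_nth)
    \<comment> \<open>The cyclic predecessor of \<open>i\<close>; adding \<open>?n\<close> first
      avoids truncated subtraction at \<open>i = 0\<close>.\<close>
    have "Suc ((i + ?n - 1) mod ?n) mod ?n = Suc (i + ?n - 1) mod ?n"
      by (rule mod_Suc_eq)
    also have "Suc (i + ?n - 1) = i + ?n" using i(1) by simp
    finally have "b = vs ! (Suc ((i + ?n - 1) mod ?n) mod ?n)" using i by simp
    moreover have "(i + ?n - 1) mod ?n < ?n" using i(1) by (intro mod_less_divisor) linarith
    ultimately show ?thesis unfolding successive_pairs_def by blast
  qed
  show "b = c" if ab: "(a, b) \<in> successive_pairs vs" "(a, c) \<in> successive_pairs vs"
  proof -
    obtain i j where ij: "i < ?n" "j < ?n" "a = vs ! i" "a = vs ! j" 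
      "b = vs ! (Suc i mod ?n)" "c = vs ! (Suc j mod ?n)"
      using ab unfolding successive_pairs_def by blast
    then have "i = j" using assms by (metis nth_eq_iff_index_eq)
    with ij show ?thesis by simp
  qed
  show "a = b" if ab: "(a, c) \<in> successive_pairs vs" "(b, c) \<in> successive_pairs vs"
  proof -
    obtain i j where ij: "i < ?n" "j < ?n" "a = vs ! i" "b = vs ! j" 
      "c = vs ! (Suc i mod ?n)" "c = vs ! (Suc j mod ?n)"
      using ab unfolding successive_pairs_def by blast
    then have "vs ! (Suc i mod ?n) = vs ! (Suc j mod ?n)" by simp
    moreover have "Suc i mod ?n < ?n" "Suc j mod ?n < ?n"
      using ij suc_less by blast+
    ultimately have "Suc i mod ?n = Suc j mod ?n"
      using assms nth_eq_iff_index_eq by blast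
    then have "i = j" using ij(1,2) by (cases "Suc i = ?n"; cases "Suc j = ?n") simp_all
    with ij show ?thesis by simp
  qed
qed

text \<open>
  Replacing the edge \<open>a b\<close> by a detour through a point \<open>t\<close> on its right gives a loop that stays
  away from \<open>m\<close>; its winding number is therefore constant near \<open>m\<close>, and the jump of the original
  winding number is that of the triangle \<open>b a t\<close>.
\<close>

lemma winding_number_jump:
  assumes "simple_polygon vs" "(a, b) \<in> successive_pairs vs" "m \<in> open_segment a b"
  obtains e where "e > 0"
    "\<And>q q'. q \<in> ball m e \<Longrightarrow> q' \<in> ball m e \<Longrightarrow> orient a b q > 0 \<Longrightarrow> orient b a q' > 0 \<Longrightarrow>
      q \<notin> path_image (boundary_path vs) \<and> q' \<notin> path_image (boundary_path vs) \<and>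
      winding_number (boundary_path vs) q = winding_number (boundary_path vs) q' + 1"
proof -
  note simp_facts = simple_polygon_vertices[OF assms(1)]
  define l where "l = vs @ [hd vs]"
  have SP: "successive_pairs vs = set (segs l)"
    using successive_pairs_segs simp_facts(2) by (simp add: l_def)
  obtain xs ys where l: "l = xs @ a # b # ys"
    using in_segsD assms(2) unfolding SP by metis
  \<comment> \<open>Multiplication by \<open>- \<i>\<close> turns \<open>b - a\<close> clockwise by
    a right angle, so \<open>t\<close> is to the right of \<open>a b\<close>, and \<open>m\<close>
    is to the left of both \<open>a t\<close> and \<open>t b\<close>.\<close>
  define t where "t = m - \<i> * (b - a)"
  define l' where "l' = xs @ a # t # b # ys"
  define F where "F = segs (xs @ [a]) @ segs (b # ys)"
  have segs_l: "segs l = segs (xs @ [a]) @ (a, b) # segs (b # ys)"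
    unfolding l by (subst segs_append) simp
  have segs_l': "segs l' = segs (xs @ [a]) @ (a, t) # (t, b) # segs (b # ys)"
    unfolding l'_def by (subst segs_append) simp
  \<comment> \<open>The pair \<open>(a, b)\<close> must occur only once in the list; a second copy
    among the remaining segments would still cover \<open>m\<close>.\<close>
  have "distinct (map fst (segs l))"
    using simp_facts(1) by (simp add: l_def map_fst_segs)
  then have "distinct (segs l)" by (simp add: distinct_map)
  then have F: "(u, v) \<in> successive_pairs vs \<and> (u, v) \<noteq> (a, b)" if "(u, v) \<in> set F" for u v
    using that unfolding SP segs_l F_def by auto
  have ab: "a \<noteq> b" using assms(3) by auto
  obtain s where s: "0 < s" "s < 1" "m = (1 - s) *\<^sub>R a + s *\<^sub>R b"
    using assms(3) by (auto simp: in_segment)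
  define N where "N = (Re b - Re a)\<^sup>2 + (Im b - Im a)\<^sup>2"
  have N: "N > 0" using ab by (auto simp: N_def sum_power2_gt_zero_iff complex_eq_iff)
  have "orient a t m = s * N" "orient t b m = (1 - s) * N" "orient a b t = - N"
    unfolding t_def s(3) N_def by (simp_all add: orient_coord algebra_simps power2_eq_square)
  with N s have atm: "orient a t m > 0" and tbm: "orient t b m > 0" and abt: "orient a b t \<le> 0"
    by simp_all
  define K where "K = (\<Union>(u, v)\<in>set F. closed_segment u v)"
  have "closed K" unfolding K_def by (intro closed_UN) auto
  moreover have "m \<notin> K"
  proof
    assume "m \<in> K"
    then obtain u v where uv: "(u, v) \<in> set F" "m \<in> closed_segment u v" by (auto simp: K_def)
    moreover have "m \<in> closed_segment a b" using assms(3) open_closed_segment by blast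
    ultimately have "m \<in> {a, b}" using simp_facts(3)[OF _ assms(2)] F[OF uv(1)] by blast
    then show False using assms(3) by (auto simp: open_segment_def)
  qed
  moreover define U where "U = - K \<inter> {q. orient a t q > 0} \<inter> {q. orient t b q > 0}"
  ultimately have "open U" "m \<in> U"
    using atm tbm by (auto simp: U_def intro: open_left)
  then obtain e where e: "e > 0" "ball m e \<subseteq> U" by (meson openE)
  have pi: "path_image (boundary_path vs) = K \<union> closed_segment a b"
    unfolding path_image_boundary[OF simp_facts(2)] SP K_def segs_l F_def by auto
  have len: "length l \<ge> 2" "length l' \<ge> 2" by (simp_all add: l l'_def)
  have pi': "path_image (polygonal_path l') = K \<union> closed_segment a t \<union> closed_segment t b"
    unfolding path_image_polygonal[OF len(2)] K_def segs_l' F_def by auto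
  let ?w = "\<lambda>u v q. winding_number (linepath u v) q"
  have off: "q \<notin> closed_segment u v" if "orient u v q > 0" for u v q
    using that orient_eq_0_on_line by fastforce
  have ball: "q \<notin> K" "orient a t q > 0" "orient t b q > 0" "q \<notin> path_image (polygonal_path l')"
    if "q \<in> ball m e" for q
    using e that off unfolding pi' U_def by auto
  have diff: "winding_number (boundary_path vs) q - winding_number (polygonal_path l') q
      = ?w a b q - ?w a t q - ?w t b q"
    if "q \<in> ball m e" "q \<notin> closed_segment a b" for q
  proof -
    have "winding_number (boundary_path vs) q = (\<Sum>(a, b)\<leftarrow>segs l. ?w a b q)"
      using winding_number_polygonal[OF len(1)] that ball[OF that(1)] pi
      by (simp add: boundary_path_def l_def)
    moreover have "winding_number (polygonal_path l') q = (\<Sum>(a, b)\<leftarrow>segs l'. ?w a b q)"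
      using winding_number_polygonal[OF len(2)] that ball[OF that(1)] by simp
    ultimately show ?thesis by (simp add: segs_l segs_l')
  qed
  have rev: "?w v u q = - ?w u v q" if "q \<notin> closed_segment u v" for u v q
    using winding_number_reversepath[of "linepath u v" q] that by simp
  have "hd l' = last l'"
  proof -
    have "hd l' = hd l" "last l' = last l" by (cases xs; simp add: l l'_def)+
    then show ?thesis using simp_facts(2) by (simp add: l_def)
  qed
  then have loop: "pathfinish (polygonal_path l') = pathstart (polygonal_path l')"
    by (subst pathfinish_polygonal pathstart_polygonal; simp add: l'_def)+
  show thesis
  proof (rule that[OF e(1)])
    fix q q' assume q: "q \<in> ball m e" "q' \<in> ball m e" "orient a b q > 0" "orient b a q' > 0"
    note b = ball[OF q(1)] and b' = ball[OF q(2)]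
    have c: "q \<notin> closed_segment a b" "q' \<notin> closed_segment b a" using q off by auto
    then have c': "q' \<notin> closed_segment a b" by (simp add: closed_segment_commute)
    have "winding_number (polygonal_path l') q = winding_number (polygonal_path l') q'"
      by (rule winding_number_eq[of _ _ "ball m e"]) (use loop q ball in auto)
    \<comment> \<open>The point \<open>q'\<close> is to the left of all three sides of
      \<open>b a t\<close>, hence inside it, while \<open>q\<close> is separated from the triangle
      by the line \<open>a b\<close>.\<close>
    moreover have "?w b a q' + ?w a t q' + ?w t b q' = 1"
      using q b' by (intro winding_number_left_of_triangle) auto
    moreover have "?w a b q + ?w b t q + ?w t a q = 0"
      using q abt by (intro winding_number_outside_triangle) auto
    moreover note diff[OF q(1) c(1)] diff[OF q(2) c']
    moreover have "?w b a q' = - ?w a b q'" by (rule rev[OF c'])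
    moreover have "?w b t q = - ?w t b q" "?w t a q = - ?w a t q"
      using rev off b by blast+
    ultimately have "winding_number (boundary_path vs) q = winding_number (boundary_path vs) q' + 1"
      by (simp add: algebra_simps)
    then show "q \<notin> path_image (boundary_path vs) \<and> q' \<notin> path_image (boundary_path vs) \<and>
      winding_number (boundary_path vs) q = winding_number (boundary_path vs) q' + 1"
      using pi b b' c c' by auto
  qed
qed

subsection \<open>The two sides of an edge\<close>

locale polygon =
  fixes Q
  assumes simple: "simple_polygon Q"
begin

abbreviation "E \<equiv> ccw_cycle Q"
abbreviation "V \<equiv> set Q"
abbreviation "B \<equiv> path_image (boundary_path Q)"

lemma E_cases: "E = successive_pairs Q \<or> E = (successive_pairs Q)\<inverse>"
  by (simp add: ccw_cycle_def)

lemma dist_Q: "distinct Q" and ne_Q: "Q \<noteq> []"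
  using simple_polygon_vertices[OF simple] by auto

lemma E_vertices: "(a, b) \<in> E \<Longrightarrow> a \<in> V \<and> b \<in> V"
  using E_cases successive_pairs_vertices(1)[OF dist_Q] by auto

lemma E_succ: "a \<in> V \<Longrightarrow> \<exists>b. (a, b) \<in> E"
  using E_cases successive_pairs_vertices(2,3)[OF dist_Q] by auto

lemma E_pred: "b \<in> V \<Longrightarrow> \<exists>a. (a, b) \<in> E"
  using E_cases successive_pairs_vertices(2,3)[OF dist_Q] by auto

lemma E_succ_unique: "(a, b) \<in> E \<Longrightarrow> (a, c) \<in> E \<Longrightarrow> b = c"
  using E_cases successive_pairs_vertices(4,5)[OF dist_Q] by auto

lemma E_pred_unique: "(a, c) \<in> E \<Longrightarrow> (b, c) \<in> E \<Longrightarrow> a = b"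
  using E_cases successive_pairs_vertices(4,5)[OF dist_Q] by auto

lemma E_Int:
  assumes "(a, b) \<in> E" "(c, d) \<in> E" "(a, b) \<noteq> (c, d)"
  shows "closed_segment a b \<inter> closed_segment c d \<subseteq> {a, b} \<inter> {c, d}"
proof (cases "E = successive_pairs Q")
  case True
  then show ?thesis using assms simple_polygon_vertices(3)[OF simple] by simp
next
  case False
  then have "E = (successive_pairs Q)\<inverse>" using E_cases by simp
  then have "(b, a) \<in> successive_pairs Q" "(d, c) \<in> successive_pairs Q" "(b, a) \<noteq> (d, c)"
    using assms by auto
  from simple_polygon_vertices(3)[OF simple this] show ?thesis
    by (simp add: closed_segment_commute insert_commute)
qed

lemma B_eq: "B = (\<Union>(a, b)\<in>E. closed_segment a b)"
proof (cases "E = successive_pairs Q")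
  case False
  then have "E = (successive_pairs Q)\<inverse>" using E_cases by simp
  then show ?thesis
    unfolding path_image_boundary[OF ne_Q] by (auto simp: closed_segment_commute)
qed (simp add: path_image_boundary[OF ne_Q])

lemma E_neq: "(a, b) \<in> E \<Longrightarrow> a \<noteq> b"
proof -
  have n: "length Q \<ge> 3" using simple by (simp add: simple_polygon_def)
  have "a \<noteq> b" if ab: "(a, b) \<in> successive_pairs Q" for a b
  proof
    assume "a = b"
    obtain i where i: "i < length Q" "a = Q ! i" "b = Q ! (Suc i mod length Q)"
      using ab unfolding successive_pairs_def by blast
    moreover have "Suc i mod length Q < length Q" using n by (intro mod_less_divisor) linarith
    ultimately have "i = Suc i mod length Q"
      using dist_Q \<open>a = b\<close> nth_eq_iff_index_eq by metis
    then show False using i(1) n by (cases "Suc i = length Q") simp_all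
  qed
  then show "(a, b) \<in> E \<Longrightarrow> a \<noteq> b" using E_cases by auto
qed

lemma V_subset_B: "V \<subseteq> B"
proof
  fix a assume "a \<in> V"
  then obtain b where "(a, b) \<in> E" using E_succ by blast
  then show "a \<in> B" unfolding B_eq by (rule UN_I) simp
qed

lemma vertex_on_edge: "(a, b) \<in> E \<Longrightarrow> c \<in> V \<Longrightarrow> c \<in> closed_segment a b \<Longrightarrow> c \<in> {a, b}"
proof -
  assume ab: "(a, b) \<in> E" "c \<in> V" "c \<in> closed_segment a b"
  obtain d where cd: "(c, d) \<in> E" using ab E_succ by blast
  show "c \<in> {a, b}"
  proof (cases "(a, b) = (c, d)")
    case False
    then show ?thesis using E_Int[OF ab(1) cd] ab(3) by auto
  qed simp
qed

lemma boundary_loop: "pathfinish (boundary_path Q) = pathstart (boundary_path Q)"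
  using ne_Q by (simp add: boundary_path_def pathfinish_polygonal pathstart_polygonal)

lemma simple_boundary: "simple_path (boundary_path Q)"
  using simple by (simp add: simple_polygon_def)

lemma wn_inside: "z \<in> inside B \<Longrightarrow> winding_number (boundary_path Q) z = (if ccw_listed Q then 1 else -1)"
proof -
  assume z: "z \<in> inside B"
  show ?thesis
  proof (cases "ccw_listed Q")
    case True
    then show ?thesis using z by (simp add: ccw_listed_def)
  next
    case False
    then show ?thesis
      using z simple_closed_path_winding_number_inside[OF simple_boundary]
      unfolding ccw_listed_def by metis
  qed
qed

lemma wn_outside: "z \<in> outside B \<Longrightarrow> winding_number (boundary_path Q) z = 0"
  by (rule winding_number_zero_in_outside)
    (use boundary_loop simple_boundary in \<open>auto intro: simple_path_imp_path\<close>)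

text \<open>The winding number takes the values 0 outside and 1 (or, for a clockwise list, -1)
  inside. A rise by one therefore leaves a single possibility for the two sides. For a clockwise
  list, \<open>a'\<close> and \<open>b'\<close> restore the listed direction.\<close>

lemma edge_sides:
  assumes "(a, b) \<in> E" "m \<in> open_segment a b"
  obtains e where "e > 0"
    "\<And>q. q \<in> ball m e \<Longrightarrow> orient a b q > 0 \<Longrightarrow> q \<in> inside B"
    "\<And>q. q \<in> ball m e \<Longrightarrow> orient b a q > 0 \<Longrightarrow> q \<in> outside B"
proof -
  define a' b' where "a' = (if ccw_listed Q then a else b)" and "b' = (if ccw_listed Q then b else a)"
  have ab': "(a', b') \<in> successive_pairs Q" "m \<in> open_segment a' b'"
    using assms by (auto simp: a'_def b'_def ccw_cycle_def open_segment_commute split: if_splits)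
  obtain e where e: "e > 0"
    "\<And>q q'. q \<in> ball m e \<Longrightarrow> q' \<in> ball m e \<Longrightarrow> orient a' b' q > 0 \<Longrightarrow> orient b' a' q' > 0 \<Longrightarrow>
      q \<notin> B \<and> q' \<notin> B \<and>
      winding_number (boundary_path Q) q = winding_number (boundary_path Q) q' + 1"
    using winding_number_jump[OF simple ab'] by metis
  have m: "orient a b m = 0"
    using assms(2) orient_eq_0_on_line open_closed_segment by blast
  \<comment> \<open>Reflection in \<open>m\<close> supplies the partner on the other side that the
    statement about two points needs.\<close>
  have refl: "orient a b (2 *\<^sub>R m - q) = - orient a b q" "orient b a (2 *\<^sub>R m - q) = - orient b a q" for q
    using m by (simp_all add: orient_coord algebra_simps)
  have ball: "2 *\<^sub>R m - q \<in> ball m e" if "q \<in> ball m e" for q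
    using that by (simp add: dist_norm scaleR_2 norm_minus_commute algebra_simps)
  have io: "z \<in> inside B \<or> z \<in> outside B" if "z \<notin> B" for z
    using that inside_Un_outside[of B] by blast
  have main: "q \<in> inside B \<and> q' \<in> outside B"
    if q: "q \<in> ball m e" "q' \<in> ball m e" "orient a b q > 0" "orient b a q' > 0" for q q'
  proof (cases "ccw_listed Q")
    case True
    then have j: "q \<notin> B" "q' \<notin> B"
      "winding_number (boundary_path Q) q = winding_number (boundary_path Q) q' + 1"
      using e(2)[of q q'] q by (simp_all add: a'_def b'_def)
    show ?thesis
      using io[OF j(1)] io[OF j(2)] j(3) True wn_inside[of q] wn_inside[of q'] wn_outside[of q] wn_outside[of q']
      by auto
  next
    case False
    then have j: "q \<notin> B" "q' \<notin> B"
      "winding_number (boundary_path Q) q' = winding_number (boundary_path Q) q + 1"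
      using e(2)[of q' q] q by (simp_all add: a'_def b'_def)
    show ?thesis
      using io[OF j(1)] io[OF j(2)] j(3) False wn_inside[of q] wn_inside[of q'] wn_outside[of q] wn_outside[of q']
      by auto
  qed
  have swap: "orient b a q = - orient a b q" for q by (rule orient_swap)
  show thesis
  proof (rule that[OF e(1)])
    fix q assume q: "q \<in> ball m e"
    { assume "orient a b q > 0"
      then show "q \<in> inside B" using main[OF q ball[OF q]] refl swap by simp }
    { assume "orient b a q > 0"
      then show "q \<in> outside B" using main[OF ball[OF q] q] refl swap by simp }
  qed
qed

lemma same_side:
  assumes "connected S" "S \<inter> B = {}" "p \<in> S" "q \<in> S"
  shows "p \<in> inside B \<longleftrightarrow> q \<in> inside B"
proof -
  have "connected_component (- B) p q" "connected_component (- B) q p"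
    using assms unfolding connected_component_def by blast+
  then show ?thesis using inside_same_component by blast
qed

text \<open>
  Unless the other edge \<open>z k\<close> runs into it, the thin sector at \<open>z\<close> between the edge \<open>z c\<close> and the
  segment \<open>z w\<close> is convex and misses the boundary, so \<open>z w\<close> inherits the side of the edge.
\<close>

lemma sector:
  assumes ab: "(a, b) \<in> E" "{a, b} = {z, c}" and ab': "(a', b') \<in> E" "{a', b'} = {z, k}"
    and only: "\<And>u v. (u, v) \<in> E \<Longrightarrow> z \<in> {u, v} \<Longrightarrow> (u, v) = (a, b) \<or> (u, v) = (a', b')"
    and free: "open_segment z w \<inter> B = {}"
    and D: "orient z c w \<noteq> 0"
    and k: "\<not> (orient z c w * orient z c k > 0 \<and> orient z c w * orient z k w \<ge> 0)"
  shows "open_segment z w \<subseteq> inside B \<longleftrightarrow> orient a b w > 0"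
proof -
  define D where "D = orient z c w"
  have D0: "D \<noteq> 0" "D * D > 0" using D by (simp_all add: D_def) (metis not_real_square_gt_zero)
  have zc: "z \<noteq> c" "z \<noteq> w" using D by auto
  define K where "K = (\<Union>(u, v)\<in>E - {(a, b), (a', b')}. closed_segment u v)"
  have "finite E"
    by (rule finite_subset[of _ "V \<times> V"]) (use E_vertices in auto)
  then have "closed K" unfolding K_def by (intro closed_UN) auto
  moreover have "z \<notin> K"
  proof
    assume "z \<in> K"
    then obtain u v where uv: "(u, v) \<in> E" "(u, v) \<noteq> (a, b)" "(u, v) \<noteq> (a', b')" "z \<in> closed_segment u v"
      by (auto simp: K_def)
    moreover have "z \<in> V" using ab E_vertices[OF ab(1)] by (auto simp: doubleton_eq_iff)
    ultimately have "z \<in> {u, v}" using vertex_on_edge by blast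
    with only uv show False by blast
  qed
  ultimately obtain d where d: "d > 0" "ball z d \<subseteq> - K"
    by (metis ComplI closed_def open_contains_ball)
  have segs: "closed_segment a b = closed_segment z c" "closed_segment a' b' = closed_segment z k"
    "open_segment a b = open_segment z c"
    using ab(2) ab'(2) by (auto simp: doubleton_eq_iff closed_segment_commute open_segment_commute)
  \<comment> \<open>The points near \<open>z\<close> on the side of \<open>w\<close> from the line
    \<open>z c\<close> and on the side of \<open>c\<close> from the line \<open>z w\<close>. The
    first condition is strict, to miss the edge; the second is not, so that \<open>C\<close>
    contains points of \<open>z w\<close> itself.\<close>
  define C where "C = ball z d \<inter> {p. D * orient z c p > 0} \<inter> {p. D * orient w z p \<ge> 0}"
  have "convex C" unfolding C_def by (intro convex_Int convex_side convex_ball)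
  then have con: "connected C" by (rule convex_connected)
  have CB: "C \<inter> B = {}"
  proof (rule equals0I)
    fix p assume p: "p \<in> C \<inter> B"
    then obtain u v where uv: "(u, v) \<in> E" "p \<in> closed_segment u v" unfolding B_eq by auto
    with p d(2) have "(u, v) = (a, b) \<or> (u, v) = (a', b')" unfolding C_def K_def by fastforce
    then have "p \<in> closed_segment z c \<or> p \<in> closed_segment z k"
      unfolding segs(1,2)[symmetric] using uv(2) by blast
    then show False
    proof
      assume "p \<in> closed_segment z c"
      then have "orient z c p = 0" by (rule orient_eq_0_on_line)
      then show False using p by (simp add: C_def)
    next
      assume "p \<in> closed_segment z k"
      then obtain r where r: "0 \<le> r" "p = (1 - r) *\<^sub>R z + r *\<^sub>R k" by (auto simp: in_segment)
      have e: "D * orient z c p = r * (D * orient z c k)" "D * orient w z p = r * (D * orient z k w)"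
        by (simp_all add: r(2) orient_coord algebra_simps)
      have "D * orient z c p > 0" "D * orient w z p \<ge> 0" using p by (simp_all add: C_def)
      then have "r * (D * orient z c k) > 0" "r * (D * orient z k w) \<ge> 0"
        unfolding e .
      then have "D * orient z c k > 0" "D * orient z k w \<ge> 0"
        using r(1) by (auto simp: zero_less_mult_iff zero_le_mult_iff)
      then show False using k by (simp add: D_def)
    qed
  qed
  obtain r where r: "0 < r" "r < 1" "z + r *\<^sub>R (c - z) \<in> ball z d"
    using exists_small_step[of "ball z d" z c] d(1) by auto
  define m where "m = z + r *\<^sub>R (c - z)"
  have "m = (1 - r) *\<^sub>R z + r *\<^sub>R c" by (simp add: m_def algebra_simps)
  then have "m \<in> open_segment a b" unfolding segs using r zc in_open_segment_combo by metis
  then obtain e where e: "e > 0" "\<And>q. q \<in> ball m e \<Longrightarrow> orient a b q > 0 \<Longrightarrow> q \<in> inside B"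
    "\<And>q. q \<in> ball m e \<Longrightarrow> orient b a q > 0 \<Longrightarrow> q \<in> outside B"
    using edge_sides[OF ab(1)] by metis
  \<comment> \<open>A short step from the edge point \<open>m\<close>, parallel to
    \<open>z w\<close>, lands in the sector and still close enough to \<open>m\<close> for
    \<open>edge_sides\<close>.\<close>
  obtain t where t: "0 < t" "t < 1" "m + t *\<^sub>R ((m + (w - z)) - m) \<in> ball m e \<inter> ball z d"
    using exists_small_step[of "ball m e \<inter> ball z d" m "m + (w - z)"] r(3) e(1) unfolding m_def[symmetric] by auto
  define p where "p = m + t *\<^sub>R (w - z)"
  have p: "p \<in> ball m e" "p \<in> ball z d" using t by (simp_all add: p_def)
  have zcp: "orient z c p = t * D"
    by (simp add: p_def m_def D_def orient_coord algebra_simps)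
  have "orient w z p = r * D"
    by (simp add: p_def m_def D_def orient_coord algebra_simps)
  then have pC: "p \<in> C"
    using D0(1) r(1) t(1) p zcp \<open>orient w z p = r * D\<close>
    by (auto simp: C_def zero_less_mult_iff zero_le_mult_iff mult_less_0_iff mult_le_0_iff)
  obtain s where s: "0 < s" "s < 1" "z + s *\<^sub>R (w - z) \<in> ball z d"
    using exists_small_step[of "ball z d" z w] d(1) by auto
  define q where "q = z + s *\<^sub>R (w - z)"
  have "orient z c q = s * D" "orient w z q = 0"
    by (simp_all add: q_def D_def orient_coord algebra_simps)
  then have qC: "q \<in> C" using s D0(1) by (auto simp: C_def q_def zero_less_mult_iff mult_less_0_iff)
  have "q = (1 - s) *\<^sub>R z + s *\<^sub>R w" by (simp add: q_def algebra_simps)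
  then have qz: "q \<in> open_segment z w" using s zc in_open_segment_combo by metis
  have "open_segment z w \<subseteq> inside B \<longleftrightarrow> q \<in> inside B"
    using same_side[OF convex_connected[OF convex_open_segment] free qz] qz by blast
  also have "\<dots> \<longleftrightarrow> p \<in> inside B" by (rule same_side[OF con CB qC pC])
  also have "\<dots> \<longleftrightarrow> orient a b w > 0"
  proof -
    have abp: "orient a b p = t * orient a b w"
    proof -
      have "(a, b) = (z, c) \<or> (a, b) = (c, z)" using ab(2) by (auto simp: doubleton_eq_iff)
      then show ?thesis using zcp orient_swap[of z c] by (auto simp: D_def)
    qed
    show ?thesis
    proof (cases "orient a b w > 0")
      case True
      then show ?thesis using e(2)[OF p(1)] abp t by simp
    next
      case False
      moreover have "orient a b w \<noteq> 0"
        using ab(2) D orient_swap[of z c] by (auto simp: doubleton_eq_iff)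
      ultimately have "orient a b w < 0" by simp
      then have "orient a b p < 0" using abp t(1) by (simp add: mult_pos_neg)
      then have "orient b a p > 0" using orient_swap[of a b p] by simp
      then have "p \<in> outside B" using e(3)[OF p(1)] by simp
      then show ?thesis using False inside_Int_outside[of B] by blast
    qed
  qed
  finally show ?thesis .
qed

end

subsection \<open>Segments between vertices\<close>

text \<open>Collinear rays from \<open>z\<close> are equal or opposite, and equal rays would make
  the open segments share all points close to \<open>z\<close>.\<close>

lemma opposite_rays:
  assumes "orient z k w = 0" "k \<noteq> z" "w \<noteq> z" "open_segment z k \<inter> open_segment z w = {}"
  obtains r where "r > 0" "k = z - r *\<^sub>R (w - z)"
proof -
  have "orient z w k = 0" using assms(1) orient_cycle orient_swap by (metis neg_equal_0_iff_equal)
  then obtain s where s: "k = z + s *\<^sub>R (w - z)" using collinear_param assms(3) by metis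
  have "s \<le> 0"
  proof (rule ccontr)
    assume "\<not> s \<le> 0"
    \<comment> \<open>A parameter below both \<open>1\<close> and \<open>s\<close>, hence the
      parameter of a point on both open segments.\<close>
    define h where "h = min 1 s / 2"
    have h: "0 < h" "h < 1" "h < s" using \<open>\<not> s \<le> 0\<close> by (auto simp: h_def)
    define q where "q = z + h *\<^sub>R (w - z)"
    have "q = (1 - h) *\<^sub>R z + h *\<^sub>R w" by (simp add: q_def algebra_simps)
    then have "q \<in> open_segment z w" using h assms(3) in_open_segment_combo by metis
    moreover have "q = (1 - h / s) *\<^sub>R z + (h / s) *\<^sub>R k"
      using h by (simp add: q_def s algebra_simps)
    moreover have "0 < h / s" "h / s < 1" using h by auto
    ultimately show False using assms(2,4) in_open_segment_combo by (metis disjoint_iff)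
  qed
  moreover have "s \<noteq> 0" using s assms(2) by auto
  ultimately show thesis using that[of "- s"] s by simp
qed

context polygon
begin

text \<open>
  The ray from \<open>z\<close> to \<open>w\<close> enters the interior angle at \<open>z\<close> between the preceding vertex \<open>p\<close> and
  the next vertex \<open>n\<close>: it is to the left of one of the two edges at \<open>z\<close>, with the other edge not in
  between. This covers convex, straight and reflex angles alike.
\<close>

definition cone :: "complex \<Rightarrow> complex \<Rightarrow> complex \<Rightarrow> complex \<Rightarrow> bool" where
  "cone n p z w \<longleftrightarrow>
     orient z n w > 0 \<and> \<not> (orient z n p > 0 \<and> orient z p w > 0) \<or>
     orient p z w > 0 \<and> \<not> (orient z w n > 0 \<and> orient z n p > 0)"

lemma edge_Int_free:
  assumes "(a, b) \<in> E" "{a, b} = {z, k}" "open_segment z w \<inter> B = {}"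
  shows "open_segment z k \<inter> open_segment z w = {}"
proof -
  have "open_segment z k \<subseteq> closed_segment a b"
    using assms(2) by (auto simp: doubleton_eq_iff open_segment_def closed_segment_commute)
  then have "open_segment z k \<subseteq> B" using assms(1) unfolding B_eq by blast
  then show ?thesis using assms(3) by blast
qed

text \<open>By \<open>sector\<close>, either edge at \<open>z\<close> decides the side unless the
  other edge shadows it, and for every pattern of signs of \<open>N\<close>, \<open>P\<close> and
  \<open>M\<close> at least one edge is unshadowed. If one of the three vanishes, the two rays
  concerned are opposite, and this ties the remaining two signs together.\<close>

lemma cone_inside:
  assumes zn: "(z, n) \<in> E" and pz: "(p, z) \<in> E" and w: "w \<noteq> z" and free: "open_segment z w \<inter> B = {}"
  shows "open_segment z w \<subseteq> inside B \<longleftrightarrow> cone n p z w"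
proof -
  define N P M where "N = orient z n w" and "P = orient z p w" and "M = orient z n p"
  have only: "(u, v) = (z, n) \<or> (u, v) = (p, z)" if "(u, v) \<in> E" "z \<in> {u, v}" for u v
    using that zn pz E_succ_unique E_pred_unique by blast
  have nz: "n \<noteq> z" "p \<noteq> z" using zn pz E_neq by blast+
  have op: "orient z p n = - M" "orient p z w = - P" "orient z w n = - N"
    by (simp_all add: M_def P_def N_def orient_coord algebra_simps)
  have secN: "open_segment z w \<subseteq> inside B \<longleftrightarrow> N > 0" if "N \<noteq> 0" "\<not> (N * M > 0 \<and> N * P \<ge> 0)"
    unfolding N_def by (rule sector[OF zn _ pz _ _ free, where c = n and k = p])
      (use that only in \<open>auto simp: N_def M_def P_def\<close>)
  have secP: "open_segment z w \<subseteq> inside B \<longleftrightarrow> P < 0" if "P \<noteq> 0" "\<not> (P * M < 0 \<and> P * N \<ge> 0)"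
  proof -
    have "open_segment z w \<subseteq> inside B \<longleftrightarrow> orient p z w > 0"
      by (rule sector[OF pz _ zn _ _ free, where c = p and k = n])
        (use that only op in \<open>auto simp: N_def M_def P_def\<close>)
    then show ?thesis using op by simp
  qed
  have disj: "open_segment z n \<inter> open_segment z w = {}" "open_segment z p \<inter> open_segment z w = {}"
    by (rule edge_Int_free[OF zn _ free], simp) (rule edge_Int_free[OF pz _ free], auto)
  have np: "open_segment z n \<inter> open_segment z p = {}"
  proof -
    have "closed_segment z n \<inter> closed_segment p z \<subseteq> {z, n} \<inter> {p, z}"
      using E_Int[OF zn pz] nz by blast
    then show ?thesis unfolding open_segment_def by (auto simp: closed_segment_commute)
  qed
  have opN: "\<exists>r>0. n = z - r *\<^sub>R (w - z)" if "N = 0"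
    using opposite_rays[of z n w] that disj nz w unfolding N_def by metis
  have opP: "\<exists>r>0. p = z - r *\<^sub>R (w - z)" if "P = 0"
    using opposite_rays[of z p w] that disj nz w unfolding P_def by metis
  have opM: "\<exists>r>0. n = z - r *\<^sub>R (p - z)" if "M = 0"
    using opposite_rays[of z n p] that np nz unfolding M_def by metis
  \<comment> \<open>If both edges pointed away from \<open>w\<close>, they would overlap, although
    they meet only in \<open>z\<close>.\<close>
  have NP0: "\<not> (N = 0 \<and> P = 0)"
  proof
    assume 0: "N = 0 \<and> P = 0"
    then obtain r s where rs: "r > 0" "s > 0" "n = z - r *\<^sub>R (w - z)" "p = z - s *\<^sub>R (w - z)"
      using opN opP by blast
    have "M = 0" unfolding M_def rs(3,4) by (simp add: orient_coord algebra_simps)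
    then obtain q where q: "q > 0" "n = z - q *\<^sub>R (p - z)" using opM by blast
    have "(r + q * s) *\<^sub>R (w - z) = 0"
      using q(2) unfolding rs by (simp add: algebra_simps)
    moreover have "r + q * s > 0" using rs q by (simp add: add_pos_pos)
    ultimately show False using w by simp
  qed
  have N0: "\<exists>r>0. M = r * P" if h: "N = 0"
  proof -
    obtain r where r: "r > 0" "n = z - r *\<^sub>R (w - z)" using opN[OF h] by blast
    then show ?thesis
      unfolding M_def P_def r(2) by (intro exI[of _ r]) (simp add: orient_coord algebra_simps)
  qed
  have P0: "\<exists>r>0. M = - (r * N)" if h: "P = 0"
  proof -
    obtain r where r: "r > 0" "p = z - r *\<^sub>R (w - z)" using opP[OF h] by blast
    then show ?thesis
      unfolding M_def N_def r(2) by (intro exI[of _ r]) (simp add: orient_coord algebra_simps)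
  qed
  have M0: "\<exists>r>0. N = - (r * P)" if h: "M = 0"
  proof -
    obtain r where r: "r > 0" "n = z - r *\<^sub>R (p - z)" using opM[OF h] by blast
    then show ?thesis
      unfolding P_def N_def r(2) by (intro exI[of _ r]) (simp add: orient_coord algebra_simps)
  qed
  have cone: "cone n p z w \<longleftrightarrow> N > 0 \<and> \<not> (M > 0 \<and> P > 0) \<or> P < 0 \<and> \<not> (N < 0 \<and> M > 0)"
    using op by (simp add: cone_def flip: N_def M_def P_def)
  consider "N = 0" "P \<noteq> 0" | "P = 0" "N \<noteq> 0" | "N > 0" "P \<noteq> 0" | "N < 0" "P \<noteq> 0"
    using NP0 by linarith
  then show ?thesis
  proof cases
    case 1
    then obtain r where "r > 0" "M = r * P" using N0 by blast
    moreover have "P * P > 0" using 1 by (metis not_real_square_gt_zero)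
    ultimately have "P * M > 0" by (simp add: mult.left_commute[of P])
    then have "\<not> (P * M < 0 \<and> P * N \<ge> 0)" by linarith
    note secP[OF 1(2) this]
    then show ?thesis using 1 unfolding cone by auto
  next
    case 2
    then obtain r where "r > 0" "M = - (r * N)" using P0 by blast
    moreover have "N * N > 0" using 2 by (metis not_real_square_gt_zero)
    ultimately have "N * M < 0" by (simp add: mult.left_commute[of N])
    then show ?thesis using secN 2 unfolding cone by auto
  next
    case 3
    show ?thesis
    proof (cases "M > 0 \<and> P > 0")
      case True
      then have "P * M > 0" by simp
      then have "\<not> (P * M < 0 \<and> P * N \<ge> 0)" by linarith
      note secP[OF 3(2) this]
      then show ?thesis using 3 True unfolding cone by auto
    next
      case False
      then have "\<not> (N * M > 0 \<and> N * P \<ge> 0)" using 3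
        by (auto simp: zero_less_mult_iff zero_le_mult_iff)
      then show ?thesis using secN 3 False unfolding cone by auto
    qed
  next
    case 4
    consider "M = 0" | "M < 0" | "M > 0" by linarith
    then show ?thesis
    proof cases
      case 1
      then obtain r where "r > 0" "N = - (r * P)" using M0 by blast
      then have "P > 0" using 4 by (simp add: zero_less_mult_iff)
      then show ?thesis using secN 1 4 unfolding cone by auto
    next
      case 2
      show ?thesis
      proof (cases "P < 0")
        case True
        then have "P * M > 0" using 2 by (rule mult_neg_neg)
        then have "\<not> (P * M < 0 \<and> P * N \<ge> 0)" by linarith
        note secP[OF 4(2) this]
        then show ?thesis using 4 2 True unfolding cone by auto
      next
        case False
        then have "\<not> (N * P \<ge> 0)" using 4 by (auto simp: zero_le_mult_iff)
        then show ?thesis using secN 4 2 False unfolding cone by auto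
      qed
    next
      case 3
      then have "\<not> N * M > 0" using 4 by (auto simp: zero_less_mult_iff)
      then show ?thesis using secN 4 3 unfolding cone by auto
    qed
  qed
qed

text \<open>A proper crossing: each line strictly separates the ends of the other segment. A
  negative orientation is written as a positive one with two points exchanged, which translates
  directly into \<open>ordccw\<close>.\<close>

definition crosses :: "complex \<Rightarrow> complex \<Rightarrow> complex \<Rightarrow> complex \<Rightarrow> bool" where
  "crosses a b u v \<longleftrightarrow>
     (orient u v a > 0 \<and> orient v u b > 0 \<or> orient v u a > 0 \<and> orient u v b > 0) \<and>
     (orient a b u > 0 \<and> orient b a v > 0 \<or> orient b a u > 0 \<and> orient a b v > 0)"

text \<open>One end of \<open>u v\<close> is strictly to the right of the edge. A short step from
  the crossing point towards that end is outside by \<open>edge_sides\<close>.\<close>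

lemma crosses_leaves:
  assumes ab: "(a, b) \<in> E" and cr: "crosses a b u v"
  obtains x where "x \<in> open_segment u v" "x \<in> outside B"
proof -
  have sw: "orient v u y = - orient u v y" "orient b a y = - orient a b y" for y
    by (rule orient_swap)+
  have uv: "u \<noteq> v" using cr by (auto simp: crosses_def)
  define A A' where "A = orient u v a" and "A' = orient u v b"
  \<comment> \<open>The zero of the affine function \<open>orient u v\<close> along
    \<open>a b\<close>.\<close>
  define r where "r = A / (A - A')"
  have AA: "A > 0 \<and> A' < 0 \<or> A < 0 \<and> A' > 0"
    using cr by (auto simp: crosses_def sw A_def A'_def)
  then have r: "0 < r" "r < 1" by (auto simp: r_def divide_simps)
  define q where "q = (1 - r) *\<^sub>R a + r *\<^sub>R b"
  have qab: "q \<in> open_segment a b"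
    unfolding q_def using r E_neq[OF ab] by (rule in_open_segment_combo)
  have "orient u v q = (1 - r) * A + r * A'" by (simp add: q_def orient_affine A_def A'_def)
  also have "\<dots> = 0" using AA by (auto simp: r_def field_simps)
  finally obtain t where t: "q = u + t *\<^sub>R (v - u)" using collinear_param uv by metis
  have "0 = orient a b q" using qab open_closed_segment orient_eq_0_on_line by metis
  also have "\<dots> = (1 - t) * orient a b u + t * orient a b v" unfolding t by (rule orient_add_scaleR)
  finally have t0: "(1 - t) * orient a b u + t * orient a b v = 0" by simp
  have UV: "orient a b u > 0 \<and> orient a b v < 0 \<or> orient a b u < 0 \<and> orient a b v > 0"
    using cr by (auto simp: crosses_def sw)
  have "0 < t" "t < 1"
  proof -
    define X Y where "X = orient a b u" and "Y = orient a b v"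
    have XY: "X > 0 \<and> Y < 0 \<or> X < 0 \<and> Y > 0" "X = t * (X - Y)"
      using UV t0 by (simp_all add: X_def Y_def algebra_simps)
    then have t': "t = X / (X - Y)" by (auto simp: field_simps)
    show "0 < t" "t < 1" unfolding t' using XY(1) by (auto simp: divide_simps)
  qed
  then have quv: "q \<in> open_segment u v"
    using in_open_segment_add[of t u v] uv t by simp
  obtain e where e: "e > 0" "\<And>y. y \<in> ball q e \<Longrightarrow> orient b a y > 0 \<Longrightarrow> y \<in> outside B"
    using edge_sides[OF ab qab] by metis
  have q0: "orient b a q = 0" using sw qab open_closed_segment orient_eq_0_on_line by (metis neg_equal_0_iff_equal)
  have step: "\<exists>x. x \<in> open_segment u v \<and> x \<in> outside B" if w: "w \<in> {u, v}" "orient b a w > 0" for w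
  proof -
    obtain s where s: "0 < s" "s < 1" "q + s *\<^sub>R (w - q) \<in> ball q e"
      using exists_small_step[of "ball q e" q w] e(1) by auto
    have "orient b a (q + s *\<^sub>R (w - q)) > 0" using q0 s w(2) by (simp add: orient_add_scaleR)
    then have "q + s *\<^sub>R (w - q) \<in> outside B" using e(2) s(3) by blast
    moreover have "q + s *\<^sub>R (w - q) \<in> open_segment u v"
    proof -
      have "q \<noteq> w" using q0 w(2) by auto
      then have "q + s *\<^sub>R (w - q) \<in> open_segment q w"
        using in_open_segment_add[of s q w] s by simp
      moreover have "open_segment q w \<subseteq> open_segment u v"
        using w(1) quv subset_oc_segment by (metis empty_iff ends_in_segment(1,2) insert_iff open_closed_segment subset_open_segment)
      ultimately show ?thesis by blast
    qed
    ultimately show ?thesis by blast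
  qed
  from UV have "orient b a v > 0 \<or> orient b a u > 0" by (auto simp: sw)
  then show thesis using step that by blast
qed

text \<open>A boundary point on the open piece is no vertex, so it is also interior to an edge. If
  the two segments do not cross properly there, they are collinear. As neither has an end of the
  other in its interior, they coincide, and the piece would be an edge.\<close>

lemma no_crossing_free:
  assumes uv: "u \<in> V" "v \<in> V" "u \<noteq> v" and empty: "V \<inter> open_segment u v = {}"
    and ne: "(u, v) \<notin> E" "(v, u) \<notin> E" and nc: "\<And>a b. (a, b) \<in> E \<Longrightarrow> \<not> crosses a b u v"
  shows "open_segment u v \<inter> B = {}"
proof (rule equals0I)
  fix q assume "q \<in> open_segment u v \<inter> B"
  then obtain a b where ab: "(a, b) \<in> E" "q \<in> closed_segment a b" and q: "q \<in> open_segment u v"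
    unfolding B_eq by auto
  have abV: "a \<in> V" "b \<in> V" "a \<noteq> b" using E_vertices E_neq ab by blast+
  have sw: "orient v u y = - orient u v y" "orient b a y = - orient a b y" for y
    by (rule orient_swap)+
  have q': "q \<in> open_segment a b"
    using ab(2) q empty abV by (auto simp: open_segment_def)
  obtain s where s: "0 < s" "s < 1" "q = (1 - s) *\<^sub>R u + s *\<^sub>R v" using q by (auto simp: in_segment)
  obtain r where r: "0 < r" "r < 1" "q = (1 - r) *\<^sub>R a + r *\<^sub>R b" using q' by (auto simp: in_segment)
  have 1: "(1 - s) * orient a b u + s * orient a b v = 0"
    using orient_eq_0_on_line[OF ab(2)] s orient_affine by metis
  have 2: "(1 - r) * orient u v a + r * orient u v b = 0"
    using orient_eq_0_on_line[of q u v] q open_closed_segment r orient_affine by metis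
  have opp: "x = 0 \<and> y = 0 \<or> x > 0 \<and> y < 0 \<or> x < 0 \<and> y > 0"
    if h: "0 < h" "h < 1" "(1 - h) * x + h * y = 0" for h x y :: real
  proof -
    consider "x = 0" | "x > 0" | "x < 0" by linarith
    then show ?thesis
    proof cases
      case 2
      then have "(1 - h) * x > 0" using h by simp
      then have "h * y < 0" using h by linarith
      then show ?thesis using h 2 by (simp add: mult_less_0_iff)
    next
      case 3
      then have "(1 - h) * x < 0" using h by (simp add: mult_pos_neg)
      then have "h * y > 0" using h by linarith
      then show ?thesis using h 3 by (simp add: zero_less_mult_iff)
    qed (use h in simp)
  qed
  note o1 = opp[OF s(1,2) 1] and o2 = opp[OF r(1,2) 2]
  have "orient a b u = 0 \<or> orient u v a = 0"
    using nc[OF ab(1)] o1 o2 by (auto simp: crosses_def sw)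
  then have a0: "orient u v a = 0 \<and> orient u v b = 0"
  proof
    assume "orient a b u = 0"
    then have "orient a b u = 0" "orient a b v = 0" using o1 by auto
    then obtain h k where hk: "u = a + h *\<^sub>R (b - a)" "v = a + k *\<^sub>R (b - a)"
      using collinear_param abV(3) by metis
    have "orient u v a = 0" unfolding hk by (simp add: orient_coord algebra_simps)
    then show ?thesis using o2 by auto
  qed (use o2 in auto)
  \<comment> \<open>On the common line, \<open>u\<close> and \<open>v\<close> have parameters 0 and
    1, \<open>a\<close> and \<open>b\<close> have \<open>h\<close> and \<open>k\<close>, and
    \<open>q\<close> has \<open>s\<close>.\<close>
  obtain h k where hk: "a = u + h *\<^sub>R (v - u)" "b = u + k *\<^sub>R (v - u)"
    using collinear_param[of u v] a0 uv(3) by metis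
  have vu: "v - u \<noteq> 0" using uv by simp
  have "(1 - r) * h + r * k = s"
  proof -
    have "((1 - r) * h + r * k) *\<^sub>R (v - u) = s *\<^sub>R (v - u)"
      using r(3) s(3) unfolding hk by (simp add: algebra_simps)
    then show ?thesis using vu by simp
  qed
  have out: "\<not> (0 < x \<and> x < 1)" if "u + x *\<^sub>R (v - u) \<in> V" for x
    using in_open_segment_add[of x u v] uv(3) empty that by auto
  have hout: "\<not> (0 < h \<and> h < 1)" "\<not> (0 < k \<and> k < 1)" using out abV hk by auto
  have noin: "y \<noteq> (1 - x) *\<^sub>R a + x *\<^sub>R b" if "y \<in> V" "0 < x" "x < 1" for x y
    using in_open_segment_combo[of x a b] that abV vertex_on_edge[OF ab(1) that(1)]
    by (auto simp: open_segment_def)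
  have in01: "\<not> (0 < x \<and> x < 1)" if "y \<in> V" "y = u + ((1 - x) * h + x * k) *\<^sub>R (v - u)" for x y
    using noin[of y x] that unfolding hk by (auto simp: algebra_simps)
  have hk0: "h \<noteq> k" using hk abV by auto
  have u: "\<not> (h < 0 \<and> 0 < k)" "\<not> (k < 0 \<and> 0 < h)"
  proof -
    \<comment> \<open>The position of \<open>u\<close> along \<open>a b\<close>; the position of
      \<open>v\<close> is \<open>(1 - h) / (k - h)\<close>.\<close>
    have "\<not> (0 < - h / (k - h) \<and> - h / (k - h) < 1)"
      by (rule in01[OF uv(1)]) (use hk0 in \<open>simp add: field_simps\<close>)
    then show "\<not> (h < 0 \<and> 0 < k)" "\<not> (k < 0 \<and> 0 < h)" by (auto simp: divide_simps)
  qed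
  have v: "\<not> (h < 1 \<and> 1 < k)" "\<not> (k < 1 \<and> 1 < h)"
  proof -
    have "(1 - (1 - h) / (k - h)) * h + (1 - h) / (k - h) * k = 1"
      using hk0 by (simp add: divide_simps) (simp add: algebra_simps)
    then have "\<not> (0 < (1 - h) / (k - h) \<and> (1 - h) / (k - h) < 1)"
      by (intro in01[OF uv(2)]) simp
    then show "\<not> (h < 1 \<and> 1 < k)" "\<not> (k < 1 \<and> 1 < h)" by (auto simp: divide_simps)
  qed
  have "h < s \<and> s < k \<or> k < s \<and> s < h"
  proof -
    have e: "s = (1 - r) * h + r * k" using \<open>(1 - r) * h + r * k = s\<close> by simp
    have "s - h = r * (k - h)" "k - s = (1 - r) * (k - h)" unfolding e by (simp_all add: algebra_simps)
    then show ?thesis using r hk0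
      by (cases "h < k") (metis diff_gt_0_iff_gt mult_pos_pos, metis diff_gt_0_iff_gt linorder_neqE_linordered_idom mult_pos_neg diff_less_0_iff_less)
  qed
  then have "h = 0 \<and> k = 1 \<or> k = 0 \<and> h = 1" using hout u v s by linarith
  then have "(a, b) = (u, v) \<or> (a, b) = (v, u)" using hk by auto
  then show False using ne ab(1) by auto
qed

lemma piece_visible:
  assumes uv: "u \<in> V" "v \<in> V" "u \<noteq> v" and empty: "V \<inter> open_segment u v = {}"
  shows "closed_segment u v \<subseteq> polygon_region Q \<longleftrightarrow>
    (u, v) \<in> E \<or> (v, u) \<in> E \<or>
    (\<forall>a b. (a, b) \<in> E \<longrightarrow> \<not> crosses a b u v) \<and> (\<exists>n p. (u, n) \<in> E \<and> (p, u) \<in> E \<and> cone n p u v)"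
proof -
  have region: "polygon_region Q = B \<union> inside B" by (simp add: polygon_region_def)
  consider "(u, v) \<in> E \<or> (v, u) \<in> E" | a b where "(a, b) \<in> E" "crosses a b u v" "(u, v) \<notin> E" "(v, u) \<notin> E"
    | "(u, v) \<notin> E" "(v, u) \<notin> E" "\<forall>a b. (a, b) \<in> E \<longrightarrow> \<not> crosses a b u v" by blast
  then show ?thesis
  proof cases
    case 1
    then have "closed_segment u v \<subseteq> B" unfolding B_eq by (auto simp: closed_segment_commute)
    then show ?thesis using 1 region by blast
  next
    case (2 a b)
    then obtain x where "x \<in> open_segment u v" "x \<in> outside B" using crosses_leaves by metis
    then have "\<not> closed_segment u v \<subseteq> polygon_region Q"
      using region outside_no_overlap[of B] inside_Int_outside[of B] open_closed_segment by blast
    then show ?thesis using 2 by blast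
  next
    case 3
    then have free: "open_segment u v \<inter> B = {}" using no_crossing_free[OF uv empty] by blast
    have "closed_segment u v \<subseteq> polygon_region Q \<longleftrightarrow> open_segment u v \<subseteq> inside B"
      using free uv V_subset_B unfolding region closed_segment_eq_open by blast
    moreover obtain n p where np: "(u, n) \<in> E" "(p, u) \<in> E" using E_succ E_pred uv by blast
    moreover have "open_segment u v \<subseteq> inside B \<longleftrightarrow> cone n' p' u v" if "(u, n') \<in> E" "(p', u) \<in> E" for n' p'
      by (rule cone_inside[OF that]) (use uv free in auto)
    ultimately show ?thesis using 3 by blast
  qed
qed

end

text \<open>A point of the segment that is not in \<open>V\<close> lies between its nearest
  neighbours in \<open>V\<close> on the segment. They exist because \<open>x\<close> and
  \<open>y\<close> are in \<open>V\<close> and \<open>V\<close> is finite, and they bound a piece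
  without inner points of \<open>V\<close>.\<close>

lemma segment_subset_pieces:
  fixes x y :: complex
  assumes V: "finite V" "x \<in> V" "y \<in> V" "x \<noteq> y" "V \<subseteq> R"
  shows "closed_segment x y \<subseteq> R \<longleftrightarrow>
    (\<forall>u\<in>V \<inter> closed_segment x y. \<forall>v\<in>V \<inter> closed_segment x y.
       u \<noteq> v \<longrightarrow> V \<inter> open_segment u v = {} \<longrightarrow> closed_segment u v \<subseteq> R)" (is "?L \<longleftrightarrow> ?R")
proof
  assume ?L
  then show ?R by (meson IntD2 closed_segment_subset convex_closed_segment order_trans)
next
  assume R: ?R
  show ?L
  proof
    fix q assume q: "q \<in> closed_segment x y"
    show "q \<in> R"
    proof (cases "q \<in> V")
      case False
      define f where "f t = (1 - t) *\<^sub>R x + t *\<^sub>R y" for t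
      have inj: "inj f"
      proof (rule injI)
        fix s t assume "f s = f t"
        then have "(s - t) *\<^sub>R (y - x) = 0" by (simp add: f_def algebra_simps)
        then show "s = t" using V(4) by simp
      qed
      obtain s where s: "0 \<le> s" "s \<le> 1" "q = f s" using q by (auto simp: in_segment f_def)
      have fseg: "f t \<in> closed_segment x y" if "0 \<le> t" "t \<le> 1" for t
        unfolding in_segment f_def using that by blast
      define T where "T = {t. 0 \<le> t \<and> t \<le> 1 \<and> f t \<in> V}"
      have "finite (f -` V)" using finite_vimageI[OF V(1) inj] .
      then have finT: "finite T" by (rule finite_subset[rotated]) (auto simp: T_def)
      have T01: "0 \<in> T" "1 \<in> T" using V by (auto simp: T_def f_def)
      have sT: "s \<notin> T" using False s by (simp add: T_def)
      have s01: "0 < s" "s < 1" using sT T01 s by (metis order_le_less)+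
      define l h where "l = Max {t \<in> T. t < s}" and "h = Min {t \<in> T. t > s}"
      have ne: "{t \<in> T. t < s} \<noteq> {}" "{t \<in> T. t > s} \<noteq> {}" using T01 s01 by auto
      have fin: "finite {t \<in> T. t < s}" "finite {t \<in> T. t > s}" using finT by auto
      have l: "l \<in> T" "l < s" using Max_in[OF fin(1) ne(1)] by (auto simp: l_def)
      have h: "h \<in> T" "s < h" using Min_in[OF fin(2) ne(2)] by (auto simp: h_def)
      have lh: "t \<notin> T" if "l < t" "t < h" for t
      proof
        assume t: "t \<in> T"
        then consider "t < s" | "t > s" using sT by (metis linorder_neqE_linordered_idom)
        then show False
        proof cases
          case 1
          then have "t \<le> l" unfolding l_def using t fin(1) by (intro Max_ge) auto
          then show False using \<open>l < t\<close> by simp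
        next
          case 2
          then have "h \<le> t" unfolding h_def using t fin(2) by (intro Min_le) auto
          then show False using \<open>t < h\<close> by simp
        qed
      qed
      have comb: "(1 - t) *\<^sub>R f l + t *\<^sub>R f h = f ((1 - t) * l + t * h)" for t
        by (simp add: f_def algebra_simps)
      have "V \<inter> open_segment (f l) (f h) = {}"
      proof (rule equals0I)
        fix z assume z: "z \<in> V \<inter> open_segment (f l) (f h)"
        then obtain t where t: "0 < t" "t < 1" "z = f ((1 - t) * l + t * h)"
          by (auto simp: in_segment comb)
        define w where "w = (1 - t) * l + t * h"
        have e: "w - l = t * (h - l)" "h - w = (1 - t) * (h - l)" by (simp_all add: w_def algebra_simps)
        have "w - l > 0" "h - w > 0" unfolding e using t l h by simp_all
        then have w: "l < w" "w < h" by simp_all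
        then have "w \<in> T" using l h z t by (simp add: T_def w_def)
        then show False using lh w by blast
      qed
      moreover have "f l \<in> V \<inter> closed_segment x y" "f h \<in> V \<inter> closed_segment x y"
        using l h fseg by (auto simp: T_def)
      moreover have "f l \<noteq> f h" using inj l h by (auto dest: injD)
      ultimately have "closed_segment (f l) (f h) \<subseteq> R" using R by blast
      moreover have "q \<in> closed_segment (f l) (f h)"
      proof -
        define t where "t = (s - l) / (h - l)"
        have t: "0 \<le> t" "t \<le> 1" using l h by (auto simp: t_def divide_simps)
        have "(1 - t) * l + t * h = l + t * (h - l)" by (simp add: algebra_simps)
        also have "\<dots> = s" using l h by (simp add: t_def)
        finally show ?thesis using comb[of t] t s(3) unfolding in_segment by metis
      qed
      ultimately show ?thesis by blast
    qed (use V in auto)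
  qed
qed

subsection \<open>The formula\<close>

context polygon
begin

text \<open>Otherwise the boundary would be a connected subset of a line, hence convex with empty
  inside, against the Jordan curve theorem.\<close>

lemma not_all_collinear:
  assumes "x \<noteq> y"
  obtains d where "d \<in> V" "orient x y d \<noteq> 0"
proof -
  have "\<exists>d\<in>V. orient x y d \<noteq> 0"
  proof (rule ccontr)
    assume "\<not> ?thesis"
    then have 0: "\<And>d. d \<in> V \<Longrightarrow> orient x y d = 0" by blast
    have line: "orient x y q = 0" if q: "q \<in> B" for q
    proof -
      obtain a b where ab: "(a, b) \<in> E" "q \<in> closed_segment a b"
        using q unfolding B_eq by blast
      then obtain t where "q = (1 - t) *\<^sub>R a + t *\<^sub>R b" by (auto simp: in_segment)
      then show ?thesis using 0 E_vertices[OF ab(1)] by (simp add: orient_affine)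
    qed
    have "collinear B"
      unfolding collinear_def
    proof (intro exI[of _ "y - x"] ballI)
      fix p q assume "p \<in> B" "q \<in> B"
      then obtain s t where pq: "p = x + s *\<^sub>R (y - x)" "q = x + t *\<^sub>R (y - x)"
        using line collinear_param assms by metis
      have "p - q = (s - t) *\<^sub>R (y - x)" unfolding pq by (simp add: algebra_simps)
      then show "\<exists>c. p - q = c *\<^sub>R (y - x)" by blast
    qed
    moreover have "connected B"
      using simple_boundary by (intro connected_path_image simple_path_imp_path)
    ultimately have "inside B = {}"
      using convex_connected_collinear inside_convex by blast
    then show False
      using Jordan_inside_outside[OF simple_boundary boundary_loop] by blast
  qed
  then show thesis using that by blast
qed

text \<open>When \<open>x\<close>, \<open>u\<close>, \<open>y\<close> are collinear, the signed
  areas of \<open>d x u\<close> and \<open>d u y\<close> add up to that of \<open>d x y\<close>.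
  Equal signs thus force \<open>x \<noteq> y\<close> and \<open>d\<close> off the line, and they
  place \<open>u\<close> at the parameter \<open>a / (a + b)\<close>, strictly between 0 and
  1.\<close>

lemma open_segment_iff_orient:
  assumes "x \<in> V" "y \<in> V" "u \<in> V"
  shows "u \<in> open_segment x y \<longleftrightarrow> orient x u y = 0 \<and>
    (\<exists>d\<in>V. orient d x u > 0 \<and> orient d u y > 0 \<or> orient d u x > 0 \<and> orient d y u > 0)"
    (is "?L \<longleftrightarrow> ?R")
proof
  assume ?L
  then obtain t where t: "0 < t" "t < 1" "u = (1 - t) *\<^sub>R x + t *\<^sub>R y" and xy: "x \<noteq> y"
    by (auto simp: in_segment)
  obtain d where d: "d \<in> V" "orient x y d \<noteq> 0" using not_all_collinear[OF xy] .
  define D where "D = orient d x y"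
  have D: "D \<noteq> 0" using d(2) by (simp add: D_def orient_cycle)
  have eq: "orient x u y = 0" "orient d x u = t * D" "orient d u x = t * (- D)"
    "orient d u y = (1 - t) * D" "orient d y u = (1 - t) * (- D)"
    unfolding t(3) D_def by (simp_all add: orient_coord algebra_simps)
  have "orient d x u > 0 \<and> orient d u y > 0 \<or> orient d u x > 0 \<and> orient d y u > 0"
    unfolding eq using t D by (cases "D > 0") (auto simp: mult_pos_neg)
  then show ?R using d(1) eq(1) by blast
next
  assume ?R
  then obtain d where 0: "orient x u y = 0"
    and d: "orient d x u > 0 \<and> orient d u y > 0 \<or> orient d u x > 0 \<and> orient d y u > 0" by blast
  define a b where "a = orient d x u" and "b = orient d u y"
  have sw: "orient d u x = - a" "orient d y u = - b"
    by (simp_all add: a_def b_def orient_coord algebra_simps)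
  have ab: "a > 0 \<and> b > 0 \<or> a < 0 \<and> b < 0"
    using d unfolding sw by (simp add: a_def b_def)
  have sum: "orient d x y = a + b"
    using 0 unfolding a_def b_def by (simp add: orient_coord algebra_simps)
  have xy: "x \<noteq> y"
  proof
    assume "x = y"
    then have "a + b = 0" using sum by simp
    then show False using ab by linarith
  qed
  have "orient x y u = 0" using 0 by (simp add: orient_coord algebra_simps)
  then obtain t where t: "u = x + t *\<^sub>R (y - x)" using collinear_param xy by metis
  have "a = t * (a + b)"
    unfolding sum[symmetric] unfolding a_def t by (simp add: orient_coord algebra_simps)
  moreover have "a + b \<noteq> 0" using ab by linarith
  ultimately have t': "t = a / (a + b)" by (simp add: field_simps)
  have "0 < t" "t < 1" unfolding t' using ab by (auto simp: divide_simps)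
  then show ?L unfolding t using xy by (rule in_open_segment_add)
qed

end

section \<open>Syntax of the formula\<close>

definition ccw_fm :: "nat \<Rightarrow> nat \<Rightarrow> nat \<Rightarrow> polygon_sym mso" where
  "ccw_fm i j k = Rel ordccw [i, j, k]"

definition edge_fm :: "nat \<Rightarrow> nat \<Rightarrow> polygon_sym mso" where
  "edge_fm i j = Rel poledge [i, j]"

text \<open>The bound variable \<open>9\<close> (which \<open>i\<close>, \<open>j\<close>, \<open>k\<close> must avoid) is a vertex off the line through \<open>i\<close> and \<open>k\<close>.\<close>

definition between_fm :: "nat \<Rightarrow> nat \<Rightarrow> nat \<Rightarrow> polygon_sym mso" where
  "between_fm i j k =
     Conj (Neg (ccw_fm i j k)) (Conj (Neg (ccw_fm i k j))
       (Exists 9 (Disj (Conj (ccw_fm 9 i j) (ccw_fm 9 j k)) (Conj (ccw_fm 9 j i) (ccw_fm 9 k j)))))"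

definition on_segment_fm :: "nat \<Rightarrow> nat \<Rightarrow> nat \<Rightarrow> polygon_sym mso" where
  "on_segment_fm i j k = Disj (Eq j i) (Disj (Eq j k) (between_fm i j k))"

definition crosses_fm :: "nat \<Rightarrow> nat \<Rightarrow> nat \<Rightarrow> nat \<Rightarrow> polygon_sym mso" where
  "crosses_fm a b u v =
     Conj (Disj (Conj (ccw_fm u v a) (ccw_fm v u b)) (Conj (ccw_fm v u a) (ccw_fm u v b)))
          (Disj (Conj (ccw_fm a b u) (ccw_fm b a v)) (Conj (ccw_fm b a u) (ccw_fm a b v)))"

definition cone_fm :: "nat \<Rightarrow> nat \<Rightarrow> nat \<Rightarrow> nat \<Rightarrow> polygon_sym mso" where
  "cone_fm n p z w =
     Disj (Conj (ccw_fm z n w) (Neg (Conj (ccw_fm z n p) (ccw_fm z p w))))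
          (Conj (ccw_fm p z w) (Neg (Conj (ccw_fm z w n) (ccw_fm z n p))))"

definition piece_fm :: "nat \<Rightarrow> nat \<Rightarrow> polygon_sym mso" where
  "piece_fm u v =
     Disj (edge_fm u v) (Disj (edge_fm v u)
       (Conj (Forall 4 (Forall 5 (Impl (edge_fm 4 5) (Neg (crosses_fm 4 5 u v)))))
             (Exists 4 (Exists 5 (Conj (edge_fm u 4) (Conj (edge_fm 5 u) (cone_fm 4 5 u v)))))))"

text \<open>Variables 2 and 3 run over consecutive vertices on the segment. Variable 4 is bound here
  and again in \<open>piece_fm\<close>, in disjoint scopes; 9 is left to
  \<open>between_fm\<close>.\<close>

definition visibility_fm :: "polygon_sym mso" where
  "visibility_fm =
     Conj (Neg (Eq 0 1)) (Forall 2 (Forall 3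
       (Impl (Conj (on_segment_fm 0 2 1) (Conj (on_segment_fm 0 3 1)
               (Conj (Neg (Eq 2 3)) (Neg (Exists 4 (between_fm 2 4 3))))))
          (piece_fm 2 3))))"

lemmas fm_defs = visibility_fm_def piece_fm_def cone_fm_def crosses_fm_def on_segment_fm_def
  between_fm_def ccw_fm_def edge_fm_def

lemma visibility_fm_binary: "mso_binary_formula polygon_arity visibility_fm"
  by (auto simp: mso_binary_formula_def fm_defs)

section \<open>Semantics of the formula in a polygon\<close>

context polygon
begin

abbreviation "M \<equiv> polygon_structure Q"

lemma universe_M [simp]: "universe M = V"
  by (simp add: polygon_structure_def)

text \<open>Since \<open>orient\<close> vanishes when two arguments coincide, a positive value
  yields the distinctness that \<open>order_type\<close> demands.\<close>

lemma sat_ccw_fm [simp]: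
  assumes "e i \<in> V" "e j \<in> V" "e k \<in> V"
  shows "mso_sat M e S (ccw_fm i j k) \<longleftrightarrow> orient (e i) (e j) (e k) > 0"
  using assms by (auto simp: ccw_fm_def polygon_structure_def order_type_def ccw_triangle_orient)

lemma sat_edge_fm [simp]: "mso_sat M e S (edge_fm i j) \<longleftrightarrow> (e i, e j) \<in> E"
  by (simp add: edge_fm_def polygon_structure_def)

lemma sat_between_fm [simp]:
  assumes "e i \<in> V" "e j \<in> V" "e k \<in> V" "i \<noteq> 9" "j \<noteq> 9" "k \<noteq> 9"
  shows "mso_sat M e S (between_fm i j k) \<longleftrightarrow> e j \<in> open_segment (e i) (e k)"
proof -
  \<comment> \<open>The two negated atoms exclude both signs, which leaves collinearity.\<close>
  have "orient (e i) (e k) (e j) = - orient (e i) (e j) (e k)"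
    by (simp add: orient_coord algebra_simps)
  then show ?thesis
    using assms by (auto simp: between_fm_def open_segment_iff_orient)
qed

lemma sat_on_segment_fm [simp]:
  assumes "e i \<in> V" "e j \<in> V" "e k \<in> V" "i \<noteq> 9" "j \<noteq> 9" "k \<noteq> 9"
  shows "mso_sat M e S (on_segment_fm i j k) \<longleftrightarrow> e j \<in> closed_segment (e i) (e k)"
  using assms by (auto simp: on_segment_fm_def closed_segment_eq_open)

lemma sat_crosses_fm [simp]:
  assumes "e a \<in> V" "e b \<in> V" "e u \<in> V" "e v \<in> V"
  shows "mso_sat M e S (crosses_fm a b u v) \<longleftrightarrow> crosses (e a) (e b) (e u) (e v)"
  using assms by (simp add: crosses_fm_def crosses_def)

lemma sat_cone_fm [simp]:
  assumes "e n \<in> V" "e p \<in> V" "e z \<in> V" "e w \<in> V"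
  shows "mso_sat M e S (cone_fm n p z w) \<longleftrightarrow> cone (e n) (e p) (e z) (e w)"
  using assms by (simp add: cone_fm_def cone_def)

lemma sat_piece_fm:
  assumes "e u \<in> V" "e v \<in> V" "e u \<noteq> e v" "V \<inter> open_segment (e u) (e v) = {}"
    and "u \<notin> {4, 5}" "v \<notin> {4, 5}"
  shows "mso_sat M e S (piece_fm u v) \<longleftrightarrow> closed_segment (e u) (e v) \<subseteq> polygon_region Q"
proof -
  have "mso_sat M e S (piece_fm u v) \<longleftrightarrow> (e u, e v) \<in> E \<or> (e v, e u) \<in> E \<or>
    (\<forall>a\<in>V. \<forall>b\<in>V. (a, b) \<in> E \<longrightarrow> \<not> crosses a b (e u) (e v)) \<and>
    (\<exists>n\<in>V. \<exists>p\<in>V. (e u, n) \<in> E \<and> (p, e u) \<in> E \<and> cone n p (e u) (e v))"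
    using assms by (simp add: piece_fm_def)
  \<comment> \<open>Edges join vertices, so the quantifiers over the universe may range over all
    points.\<close>
  also have "\<dots> \<longleftrightarrow> (e u, e v) \<in> E \<or> (e v, e u) \<in> E \<or>
    (\<forall>a b. (a, b) \<in> E \<longrightarrow> \<not> crosses a b (e u) (e v)) \<and>
    (\<exists>n p. (e u, n) \<in> E \<and> (p, e u) \<in> E \<and> cone n p (e u) (e v))"
    using E_vertices by blast
  finally show ?thesis using piece_visible[OF assms(1-4)] by blast
qed

lemma sat_visibility_fm:
  assumes "x \<in> V" "y \<in> V"
  shows "mso_sat2 M visibility_fm x y \<longleftrightarrow> x \<noteq> y \<and> closed_segment x y \<subseteq> polygon_region Q"
proof (cases "x = y")
  case True
  then show ?thesis by (simp add: mso_sat2_def visibility_fm_def)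
next
  case False
  have "V \<subseteq> polygon_region Q" using V_subset_B by (auto simp: polygon_region_def)
  note pieces = segment_subset_pieces[OF finite_set assms False this]
  have empty: "(\<exists>w\<in>V. w \<in> open_segment u v) \<longleftrightarrow> V \<inter> open_segment u v \<noteq> {}" for u v
    by blast
  have "mso_sat2 M visibility_fm x y \<longleftrightarrow>
    (\<forall>u\<in>V. \<forall>v\<in>V. u \<in> closed_segment x y \<and> v \<in> closed_segment x y \<and> u \<noteq> v \<and>
       V \<inter> open_segment u v = {} \<longrightarrow> closed_segment u v \<subseteq> polygon_region Q)"
    using assms False
    \<comment> \<open>The congruence rules make the premises of the implication, in particular the
      empty open segment, available to the conditional rule \<open>sat_piece_fm\<close>.\<close>
    by (simp add: mso_sat2_def visibility_fm_def sat_piece_fm empty cong: conj_cong imp_cong)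
  also have "\<dots> \<longleftrightarrow> closed_segment x y \<subseteq> polygon_region Q"
    unfolding pieces by blast
  finally show ?thesis using False by blast
qed

end

theorem theorem7:
  "\<exists>\<epsilon> :: polygon_sym mso. mso_binary_formula polygon_arity \<epsilon> \<and>
     (\<forall>Q :: complex list. simple_polygon Q \<longrightarrow>
        (\<forall>x \<in> set Q. \<forall>y \<in> set Q.
           mso_sat2 (polygon_structure Q) \<epsilon> x y \<longleftrightarrow> {x, y} \<in> visibility_edges Q))"
proof (intro exI[of _ visibility_fm] conjI allI impI ballI)
  show "mso_binary_formula polygon_arity visibility_fm" by (rule visibility_fm_binary)
  fix Q x y assume Q: "simple_polygon Q" and xy: "x \<in> set Q" "y \<in> set Q"
  interpret polygon Q by (rule polygon.intro[OF Q])
  have "{x, y} \<in> visibility_edges Q \<longleftrightarrow> x \<noteq> y \<and> closed_segment x y \<subseteq> polygon_region Q"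
    using xy by (auto simp: visibility_edges_def doubleton_eq_iff closed_segment_commute)
  then show "mso_sat2 (polygon_structure Q) visibility_fm x y \<longleftrightarrow> {x, y} \<in> visibility_edges Q"
    using sat_visibility_fm[OF xy] by blast
qed

end
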